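(* Let $V$ be a separable Banach space and let $\mathcal{E}=\mathcal{E}(V)$ be its (separable) enveloping semigroup. We have the following alternative. Either (1) $\mathcal{E}$ is a Rosenthal compactum, hence $\operatorname{card}\mathcal{E}\le 2^{\aleph_0}$; or (2) the compact space $\mathcal{E}$ contains a homeomorphic copy of $\beta\mathbb{N}$, hence $\operatorname{card}\mathcal{E}=2^{2^{\aleph_0}}$. The first possibility holds if and only if $V$ is a Rosenthal Banach space.
   Context: Banach spaces are real. $\Theta(V)$ is the semigroup of all linear operators $T:V\to V$ with $\|T\|\le 1$. $B^*$ is the closed unit ball of $V^*$ with the weak$^*$ topology. The enveloping semigroup $\mathcal{E}(V)$ of $V$ is the closure of $\{T^*|_{B^*}: T\in\Theta(V)\}$ in $(B^* )^{B^*}$ with the product (pointwise weak$^*$) topology; its operation is composition. A Banach space is Rosenthal if it does not contain an isomorphic copy of $l_1$. A topological space is a Rosenthal compactum if it is homeomorphic to a pointwise compact subset of the space $\mathcal{B}_1(X)$ of real-valued Baire class 1 functions on some Polish space $X$ (with the topology of pointwise convergence). $\beta\mathbb{N}$ is the Čech–Stone compactification of the discrete space $\mathbb{N}$. *)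

theory Defs
  imports "HOL-Analysis.Analysis"
begin

section \<open>The Banach space \<open>l\<^sub>1\<close> and Rosenthal Banach spaces\<close>

typedef l1 = "{a :: nat \<Rightarrow> real. summable (\<lambda>n. \<bar>a n\<bar>)}"
  morphisms l1_nth Abs_l1
  by (rule exI[of _ "\<lambda>_. 0"]) simp

setup_lifting type_definition_l1

instantiation l1 :: real_vector
begin

lift_definition zero_l1 :: l1 is "\<lambda>_. 0" by simp

lift_definition plus_l1 :: "l1 \<Rightarrow> l1 \<Rightarrow> l1" is "\<lambda>a b n. a n + b n"
  subgoal for a b
    by (rule summable_comparison_test'[OF summable_add[of "\<lambda>n. \<bar>a n\<bar>" "\<lambda>n. \<bar>b n\<bar>"]])
      (auto simp: abs_triangle_ineq)
  done

lift_definition uminus_l1 :: "l1 \<Rightarrow> l1" is "\<lambda>a n. - a n" by simp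

lift_definition minus_l1 :: "l1 \<Rightarrow> l1 \<Rightarrow> l1" is "\<lambda>a b n. a n - b n"
  subgoal for a b
    by (rule summable_comparison_test'[OF summable_add[of "\<lambda>n. \<bar>a n\<bar>" "\<lambda>n. \<bar>b n\<bar>"]])
      (auto simp: abs_triangle_ineq4)
  done

lift_definition scaleR_l1 :: "real \<Rightarrow> l1 \<Rightarrow> l1" is "\<lambda>r a n. r * a n"
  by (auto simp: abs_mult intro: summable_mult)

instance
  by standard (transfer; simp add: algebra_simps)+

end

instantiation l1 :: real_normed_vector
begin

lift_definition norm_l1 :: "l1 \<Rightarrow> real" is "\<lambda>a. \<Sum>n. \<bar>a n\<bar>" .

definition sgn_l1 :: "l1 \<Rightarrow> l1" where "sgn_l1 x = x /\<^sub>R norm x"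

definition dist_l1 :: "l1 \<Rightarrow> l1 \<Rightarrow> real" where "dist_l1 x y = norm (x - y)"

definition uniformity_l1 :: "(l1 \<times> l1) filter"
  where "uniformity_l1 = (INF e\<in>{0<..}. principal {(x, y). dist x y < e})"

definition open_l1 :: "l1 set \<Rightarrow> bool"
  where "open_l1 U \<longleftrightarrow> (\<forall>x\<in>U. eventually (\<lambda>(x', y). x' = x \<longrightarrow> y \<in> U) uniformity)"

instance
proof
  fix x y :: l1 and r s :: real
  show "sgn x = x /\<^sub>R norm x" by (fact sgn_l1_def)
  show "dist x y = norm (x - y)" by (fact dist_l1_def)
  show "norm x = 0 \<longleftrightarrow> x = 0"
    by transfer (auto simp: suminf_eq_zero_iff fun_eq_iff)
  show "norm (x + y) \<le> norm x + norm y"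
  proof transfer
    fix a b :: "nat \<Rightarrow> real"
    assume ab: "summable (\<lambda>n. \<bar>a n\<bar>)" "summable (\<lambda>n. \<bar>b n\<bar>)"
    have "summable (\<lambda>n. \<bar>a n + b n\<bar>)"
      by (rule summable_comparison_test'[OF summable_add[OF ab]]) (auto simp: abs_triangle_ineq)
    then have "(\<Sum>n. \<bar>a n + b n\<bar>) \<le> (\<Sum>n. \<bar>a n\<bar> + \<bar>b n\<bar>)"
      by (intro suminf_le summable_add ab) (auto simp: abs_triangle_ineq)
    then show "(\<Sum>n. \<bar>a n + b n\<bar>) \<le> (\<Sum>n. \<bar>a n\<bar>) + (\<Sum>n. \<bar>b n\<bar>)"
      by (simp add: suminf_add ab)
  qed
  show "norm (r *\<^sub>R x) = \<bar>r\<bar> * norm x"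
    by transfer (simp add: abs_mult suminf_mult)
qed (simp_all add: uniformity_l1_def open_l1_def)

end

definition contains_isomorphic_copy_of_l1 :: "'a::real_normed_vector itself \<Rightarrow> bool"
  where "contains_isomorphic_copy_of_l1 _ \<longleftrightarrow>
    (\<exists>(J :: l1 \<Rightarrow> 'a) K. linear J \<and> homeomorphism UNIV (range J) J K)"

definition Rosenthal_Banach_space :: "'a::banach itself \<Rightarrow> bool"
  where "Rosenthal_Banach_space V \<longleftrightarrow> \<not> contains_isomorphic_copy_of_l1 V"


section \<open>The enveloping semigroup of a Banach space\<close>

definition weak_star_topology :: "('a::real_normed_vector \<Rightarrow>\<^sub>L real) topology"
  where "weak_star_topology =
    pullback_topology UNIV blinfun_apply (product_topology (\<lambda>_. euclideanreal) UNIV)"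

definition dual_ball :: "('a::real_normed_vector \<Rightarrow>\<^sub>L real) topology"
  where "dual_ball = subtopology weak_star_topology (cball 0 1)"

definition adjoint_op :: "('a::real_normed_vector \<Rightarrow>\<^sub>L 'a) \<Rightarrow> ('a \<Rightarrow>\<^sub>L real) \<Rightarrow> ('a \<Rightarrow>\<^sub>L real)"
  where "adjoint_op T \<phi> = \<phi> o\<^sub>L T"

definition dual_ball_self_maps :: "(('a::real_normed_vector \<Rightarrow>\<^sub>L real) \<Rightarrow> ('a \<Rightarrow>\<^sub>L real)) topology"
  where "dual_ball_self_maps = product_topology (\<lambda>_. dual_ball) (topspace dual_ball)"

definition enveloping_semigroup ::
  "'a::banach itself \<Rightarrow> (('a \<Rightarrow>\<^sub>L real) \<Rightarrow> ('a \<Rightarrow>\<^sub>L real)) topology"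
  where "enveloping_semigroup _ = subtopology dual_ball_self_maps
    (dual_ball_self_maps closure_of
      {restrict (adjoint_op T) (topspace dual_ball) | T :: 'a \<Rightarrow>\<^sub>L 'a. norm T \<le> 1})"

lemma topspace_dual_ball: "topspace dual_ball = cball 0 1"
  by (simp add: dual_ball_def weak_star_topology_def topspace_pullback_topology)

lemma restrict_adjoint_op_in_dual_ball_self_maps:
  fixes T :: "'a::real_normed_vector \<Rightarrow>\<^sub>L 'a"
  assumes "norm T \<le> 1"
  shows "restrict (adjoint_op T) (topspace dual_ball) \<in> topspace dual_ball_self_maps"
proof -
  have "norm (\<phi> o\<^sub>L T) \<le> 1" if "norm \<phi> \<le> 1" for \<phi> :: "'a \<Rightarrow>\<^sub>L real"
    using norm_blinfun_compose[of \<phi> T] mult_mono[of "norm \<phi>" 1 "norm T" 1] that assms by simp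
  then show ?thesis
    by (auto simp: dual_ball_self_maps_def topspace_dual_ball adjoint_op_def)
qed


section \<open>Rosenthal compacta\<close>

definition Polish_space :: "'b topology \<Rightarrow> bool"
  where "Polish_space X \<longleftrightarrow> completely_metrizable_space X \<and> separable_space X"

definition pointwise_topology :: "'b topology \<Rightarrow> ('b \<Rightarrow> real) topology"
  where "pointwise_topology X = product_topology (\<lambda>_. euclideanreal) (topspace X)"

definition Baire_class_1 :: "'b topology \<Rightarrow> ('b \<Rightarrow> real) set"
  where "Baire_class_1 X = {f \<in> extensional (topspace X).
    \<exists>g. (\<forall>n::nat. continuous_map X euclideanreal (g n)) \<and>
        (\<forall>x\<in>topspace X. (\<lambda>n. g n x) \<longlonglongrightarrow> f x)}"

text \<open>
  HOL cannot quantify over the type carrying the Polish space \<open>X\<close>. The carrier is taken to be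
  a subset of \<open>\<real>\<close> (with an arbitrary Polish topology); since a Polish space has
  at most continuum many points, this is no restriction, as lemma \<open>Rosenthal_compactumI\<close> shows.
\<close>

definition Rosenthal_compactum :: "'c topology \<Rightarrow> bool"
  where "Rosenthal_compactum K \<longleftrightarrow>
    (\<exists>(X :: real topology) F. Polish_space X \<and> F \<subseteq> Baire_class_1 X \<and>
      compactin (pointwise_topology X) F \<and>
      K homeomorphic_space subtopology (pointwise_topology X) F)"

lemma Polish_space_lepoll_reals:
  assumes "Polish_space X"
  shows "topspace X \<lesssim> (UNIV :: real set)"
proof -
  obtain M d where "Metric_space M d" and XM: "X = Metric_space.mtopology M d"
    using assms by (auto simp: Polish_space_def completely_metrizable_space_def)
  then interpret Metric_space M d by simp
  have top: "topspace X = M"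
    by (simp add: XM)
  obtain C where C: "countable C" "C \<subseteq> M" "mtopology closure_of C = M"
    using assms by (auto simp: Polish_space_def separable_space_def XM)
  define D where "D = C \<times> (\<rat> :: real set)"
  have "countable D"
    using C(1) by (simp add: D_def countable_rat)
  define e where "e x = to_nat_on D ` {p \<in> D. d (fst p) x < snd p}" for x
  have "inj_on e (topspace X)"
  proof (rule inj_onI, rule ccontr)
    fix x y assume xy: "x \<in> topspace X" "y \<in> topspace X" "e x = e y" "x \<noteq> y"
    then have M: "x \<in> M" "y \<in> M" and pos: "d x y / 2 > 0"
      by (auto simp: top)
    have "x \<in> mtopology closure_of C"
      using C(3) M by simp
    then have "\<exists>c\<in>C. c \<in> mball x (d x y / 2)"
      using pos unfolding metric_closure_of by blast
    then obtain c where c: "c \<in> C" "d x c < d x y / 2"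
      using in_mball by blast
    then have "c \<in> M" using C(2) by blast
    then have "d c x < d c y"
      using c(2) M triangle[of x c y] commute[of x c] by linarith
    then obtain q where q: "q \<in> \<rat>" "d c x < q" "q < d c y"
      using Rats_dense_in_real by blast
    have "(c, q) \<in> {p \<in> D. d (fst p) x < snd p}" "(c, q) \<notin> {p \<in> D. d (fst p) y < snd p}"
      using c q by (auto simp: D_def)
    moreover have "{p \<in> D. d (fst p) x < snd p} = {p \<in> D. d (fst p) y < snd p}"
      using xy(3) inj_on_image_eq_iff[OF inj_on_to_nat_on[OF \<open>countable D\<close>]]
      unfolding e_def by blast
    ultimately show False by simp
  qed
  then have "topspace X \<lesssim> (UNIV :: nat set set)"
    unfolding lepoll_def by blast
  then show ?thesis
    using nat_sets_eqpoll_reals lepoll_trans2 by blast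
qed

lemma Rosenthal_compactumI:
  fixes X :: "'b topology"
  assumes "Polish_space X" "F \<subseteq> Baire_class_1 X" "compactin (pointwise_topology X) F"
    "K homeomorphic_space subtopology (pointwise_topology X) F"
  shows "Rosenthal_compactum K"
proof -
  obtain h :: "'b \<Rightarrow> real" where h: "inj_on h (topspace X)"
    using Polish_space_lepoll_reals[OF assms(1)] unfolding lepoll_def by blast
  define k where "k = inv_into (topspace X) h"
  define Y where "Y = pullback_topology (h ` topspace X) k X"
  have kh: "k (h x) = x" if "x \<in> topspace X" for x
    using that h by (simp add: k_def)
  have topY: "topspace Y = h ` topspace X"
    using kh by (auto simp: Y_def topspace_pullback_topology)
  have cont_k: "continuous_map Y X k"
    using continuous_map_pullback[OF continuous_map_id[of X], of "h ` topspace X" k]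
    by (simp add: Y_def)
  have cont_h: "continuous_map X Y h"
    unfolding Y_def
  proof (rule continuous_map_pullback')
    show "continuous_map X X (k \<circ> h)"
      by (rule continuous_map_eq[OF continuous_map_id]) (simp add: kh)
  qed auto
  have hk: "k y \<in> topspace X" "h (k y) = y" if "y \<in> topspace Y" for y
    using that kh by (auto simp: topY)
  have "homeomorphic_maps X Y h k"
    using cont_h cont_k kh hk by (simp add: homeomorphic_maps_def)
  then have XY: "X homeomorphic_space Y"
    by (auto simp: homeomorphic_space_def)
  define G where "G f = restrict (f \<circ> k) (topspace Y)" for f :: "'b \<Rightarrow> real"
  define H where "H f = restrict (f \<circ> h) (topspace X)" for f :: "real \<Rightarrow> real"
  have G: "continuous_map (pointwise_topology X) (pointwise_topology Y) G"
    unfolding pointwise_topology_def continuous_map_componentwise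
    using hk by (auto simp: G_def intro: continuous_map_product_projection)
  have H: "continuous_map (pointwise_topology Y) (pointwise_topology X) H"
    unfolding pointwise_topology_def continuous_map_componentwise
    by (auto simp: H_def topY intro: continuous_map_product_projection)
  have "homeomorphic_maps (pointwise_topology X) (pointwise_topology Y) G H"
    unfolding homeomorphic_maps_def
  proof (intro conjI G H ballI)
    fix f assume "f \<in> topspace (pointwise_topology X)"
    then have "f \<in> extensional (topspace X)"
      by (auto simp: pointwise_topology_def PiE_def)
    then show "H (G f) = f"
      by (auto simp: fun_eq_iff G_def H_def topY kh extensional_def)
  next
    fix f assume "f \<in> topspace (pointwise_topology Y)"
    then have "f \<in> extensional (topspace Y)"
      by (auto simp: pointwise_topology_def PiE_def)
    then show "G (H f) = f"
      using hk by (auto simp: fun_eq_iff G_def H_def extensional_def)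
  qed
  then have Ghom: "homeomorphic_map (pointwise_topology X) (pointwise_topology Y) G"
    using homeomorphic_map_maps by blast
  have Fsub: "F \<subseteq> topspace (pointwise_topology X)"
    using assms(3) by (simp add: compactin_subset_topspace)
  have "Polish_space Y"
    using assms(1) homeomorphic_completely_metrizable_space[OF XY] homeomorphic_separable_space[OF XY]
    by (simp add: Polish_space_def)
  moreover have "G ` F \<subseteq> Baire_class_1 Y"
  proof (rule image_subsetI)
    fix f assume "f \<in> F"
    then obtain g where g: "\<And>n::nat. continuous_map X euclideanreal (g n)"
      "\<And>x. x \<in> topspace X \<Longrightarrow> (\<lambda>n. g n x) \<longlonglongrightarrow> f x"
      using assms(2) unfolding Baire_class_1_def by blast
    have "\<forall>n. continuous_map Y euclideanreal (g n \<circ> k)"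
      using continuous_map_compose[OF cont_k g(1)] by blast
    moreover have "\<forall>y\<in>topspace Y. (\<lambda>n. (g n \<circ> k) y) \<longlonglongrightarrow> G f y"
      using g(2) hk by (simp add: G_def)
    moreover have "G f \<in> extensional (topspace Y)"
      by (simp add: G_def)
    ultimately show "G f \<in> Baire_class_1 Y"
      unfolding Baire_class_1_def
      by (intro CollectI conjI exI[of _ "\<lambda>n. g n \<circ> k"]) auto
  qed
  moreover have "compactin (pointwise_topology Y) (G ` F)"
    using image_compactin[OF assms(3) G] .
  moreover have "K homeomorphic_space subtopology (pointwise_topology Y) (G ` F)"
  proof (rule homeomorphic_space_trans[OF assms(4)])
    have "homeomorphic_map (subtopology (pointwise_topology X) F)
        (subtopology (pointwise_topology Y) (G ` F)) G"
      by (rule homeomorphic_map_subtopologies[OF Ghom])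
        (use Fsub Ghom in \<open>auto simp: homeomorphic_eq_everything_map\<close>)
    then show "subtopology (pointwise_topology X) F
        homeomorphic_space subtopology (pointwise_topology Y) (G ` F)"
      by (rule homeomorphic_map_imp_homeomorphic_space)
  qed
  ultimately show ?thesis
    unfolding Rosenthal_compactum_def by blast
qed


section \<open>The Cech--Stone compactification\<close>

text \<open>The closure of the canonical image of \<open>X\<close> in the cube \<open>[0,1]\<^bsup>C(X,[0,1])\<^esup>\<close>.\<close>

definition Cech_Stone :: "'b topology \<Rightarrow> (('b \<Rightarrow> real) \<Rightarrow> real) topology"
  where "Cech_Stone X =
    (let C = {f \<in> extensional (topspace X). continuous_map X (top_of_set {0..1}) f};
         cube = product_topology (\<lambda>_. top_of_set {0..1}) C
     in subtopology cube (cube closure_of ((\<lambda>x. \<lambda>f\<in>C. f x) ` topspace X)))"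

definition beta_nat :: "((nat \<Rightarrow> real) \<Rightarrow> real) topology"
  where "beta_nat = Cech_Stone (discrete_topology UNIV)"

definition contains_homeomorphic_copy :: "'c topology \<Rightarrow> 'd topology \<Rightarrow> bool"
  where "contains_homeomorphic_copy X Y \<longleftrightarrow>
    (\<exists>S \<subseteq> topspace X. subtopology X S homeomorphic_space Y)"

end

theory Submission
  imports Defs
begin

text \<open>
  Write \<open>B\<close> for the dual ball. An element \<open>p\<close> of the enveloping semigroup is determined by the
  functions \<open>\<phi> \<mapsto> p \<phi> v\<close> on \<open>B\<close>, each of which is a pointwise limit of evaluations at the vectors
  \<open>T v\<close> with \<open>T\<close> a contraction. Everything depends on whether these functions are of the first
  Baire class.

  Suppose that \<open>V\<close> contains no copy of \<open>l\<^sub>1\<close>. A bounded function on the compact metrizable space \<open>B\<close>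
  that is not of the first Baire class has, for some \<open>a < b\<close> and on some nonempty closed set, values at
  most \<open>a\<close> densely and values at least \<open>b\<close> densely (\<open>no_oscillation_imp_limit_of_continuous\<close>).
  Approximating such a function at finitely many points at a time gives vectors \<open>w n\<close> of the form \<open>T v\<close>
  that realize all sign patterns on \<open>B\<close> (\<open>oscillation_imp_independent_sequence\<close>), and such vectors
  are equivalent to the unit vector basis of \<open>l\<^sub>1\<close> (\<open>independent_lower_bound\<close>,
  \<open>l1_basis_imp_copy\<close>). Hence all coordinates are of the first Baire class, and with a dense
  sequence \<open>d\<close> the map \<open>p \<mapsto> (\<lambda>(\<phi>, n). p \<phi> (d n))\<close> exhibits the enveloping semigroup as a Rosenthal
  compactum (\<open>no_l1_imp_Rosenthal_compactum\<close>).

  Suppose conversely that \<open>v n\<close> is the image of the unit vector basis of \<open>l\<^sub>1\<close>. By the Hahn-Banach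
  theorem the sequences \<open>\<psi> (v n)\<close>, for \<open>\<psi>\<close> in \<open>B\<close>, include all sequences in some fixed interval.
  Therefore the adjoints of suitable rank-one contractions, the \<open>n\<close>-th one having its range spanned
  by \<open>v n\<close>, have the Cech-Stone compactification of the natural numbers as their closure
  (\<open>l1_imp_beta_nat\<close>).

  The two cases exclude each other for reasons of cardinality. A function of the first Baire class
  is coded by the values of countably many continuous functions on a countable dense set, so a
  Rosenthal compactum has at most continuum many points (\<open>Rosenthal_compactum_lepoll\<close>). An
  independent family of continuum many subsets of the natural numbers shows that the
  compactification has at least as many points as there are sets of sets of natural numbers
  (\<open>nat_sets_sets_lepoll_beta_nat\<close>). As \<open>V\<close> is separable, \<open>B\<close> has at most continuum many
  points, and its self-maps are no more numerous than that bound (\<open>enveloping_semigroup_lepoll\<close>).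
\<close>

section \<open>Hahn-Banach extension\<close>

definition sublinear :: "('a::real_vector \<Rightarrow> real) \<Rightarrow> bool"
  where "sublinear q \<longleftrightarrow>
    (\<forall>x y. q (x + y) \<le> q x + q y) \<and> (\<forall>t x. 0 < t \<longrightarrow> q (t *\<^sub>R x) \<le> t * q x)"

lemma sublinear_add: "sublinear q \<Longrightarrow> q (x + y) \<le> q x + q y"
  by (simp add: sublinear_def)

lemma sublinear_scaleR_le: "sublinear q \<Longrightarrow> 0 < t \<Longrightarrow> q (t *\<^sub>R x) \<le> t * q x"
  by (simp add: sublinear_def)

lemma sublinear_zero: assumes "sublinear q" shows "q 0 = 0"
  using sublinear_scaleR_le[OF assms, of 2 0] sublinear_scaleR_le[OF assms, of "1/2" 0] by simp

lemma sublinear_scaleR: assumes "sublinear q" "0 \<le> t" shows "q (t *\<^sub>R x) = t * q x"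
proof (cases "t = 0")
  case True
  then show ?thesis by (simp add: sublinear_zero[OF assms(1)])
next
  case False
  then have t: "0 < t" using assms by simp
  have "q x \<le> inverse t * q (t *\<^sub>R x)"
    using sublinear_scaleR_le[OF assms(1), of "inverse t" "t *\<^sub>R x"] t by simp
  then have "t * q x \<le> q (t *\<^sub>R x)"
    using t by (simp add: field_simps)
  then show ?thesis
    using sublinear_scaleR_le[OF assms(1) t, of x] by simp
qed

lemma sublinear_lower: assumes "sublinear q" shows "- q (- x) \<le> q x"
  using sublinear_add[OF assms, of x "- x"] sublinear_zero[OF assms] by simp

lemma chain_Inf_sublinear:
  assumes "C \<noteq> {}" and sub: "\<And>q. q \<in> C \<Longrightarrow> sublinear q \<and> (\<forall>x. q x \<le> p x)"
    and chain: "\<And>q r. q \<in> C \<Longrightarrow> r \<in> C \<Longrightarrow> (\<forall>x. q x \<le> r x) \<or> (\<forall>x. r x \<le> q x)"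
  shows "bdd_below ((\<lambda>q. q x) ` C)" "sublinear (\<lambda>x. INF q\<in>C. q x)"
proof -
  have bdd: "bdd_below ((\<lambda>q. q x) ` C)" for x
  proof (rule bdd_belowI2)
    fix q assume "q \<in> C"
    then have "- q (- x) \<le> q x" "q (- x) \<le> p (- x)"
      using sub sublinear_lower by blast+
    then show "- p (- x) \<le> q x" by linarith
  qed
  show "bdd_below ((\<lambda>q. q x) ` C)" by (fact bdd)
  have add: "(INF q\<in>C. q (x + y)) \<le> (INF q\<in>C. q x) + (INF q\<in>C. q y)" for x y
  proof -
    have *: "(INF q\<in>C. q (x + y)) \<le> q x + r y" if qr: "q \<in> C" "r \<in> C" for q r
    proof -
      \<comment> \<open>In a chain the smaller of \<open>q\<close> and \<open>r\<close> bounds both summands at once.\<close>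
      obtain s where s: "s \<in> C" "\<forall>x. s x \<le> q x" "\<forall>x. s x \<le> r x"
        using chain[OF qr] qr by blast
      have "(INF q\<in>C. q (x + y)) \<le> s (x + y)"
        by (rule cINF_lower[OF bdd s(1)])
      also have "\<dots> \<le> s x + s y" using sub[OF s(1)] sublinear_add by blast
      also have "\<dots> \<le> q x + r y" using s by (simp add: add_mono)
      finally show ?thesis .
    qed
    have "(INF q\<in>C. q (x + y)) - r y \<le> (INF q\<in>C. q x)" if "r \<in> C" for r
      by (rule cINF_greatest[OF assms(1)]) (use *[OF _ that] in \<open>simp add: algebra_simps\<close>)
    then have "(INF q\<in>C. q (x + y)) - (INF q\<in>C. q x) \<le> r y" if "r \<in> C" for r
      using that by (simp add: algebra_simps)
    then have "(INF q\<in>C. q (x + y)) - (INF q\<in>C. q x) \<le> (INF q\<in>C. q y)"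
      by (intro cINF_greatest[OF assms(1)]) 
    then show ?thesis by simp
  qed
  have scale: "(INF q\<in>C. q (t *\<^sub>R x)) \<le> t * (INF q\<in>C. q x)" if "0 < t" for t x
  proof -
    have "inverse t * (INF q\<in>C. q (t *\<^sub>R x)) \<le> (INF q\<in>C. q x)"
    proof (rule cINF_greatest[OF assms(1)])
      fix q assume q: "q \<in> C"
      have "(INF q\<in>C. q (t *\<^sub>R x)) \<le> q (t *\<^sub>R x)" by (rule cINF_lower[OF bdd q])
      also have "\<dots> \<le> t * q x" using sub[OF q] sublinear_scaleR_le that by blast
      finally show "inverse t * (INF q\<in>C. q (t *\<^sub>R x)) \<le> q x"
        using that by (simp add: field_simps)
    qed
    then show ?thesis using that by (simp add: field_simps)
  qed
  show "sublinear (\<lambda>x. INF q\<in>C. q x)"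
    using add scale by (simp add: sublinear_def)
qed

text \<open>
  Linear functionals are exactly the minimal sublinear ones. The infimum over all steps in a
  direction \<open>y\<close> produces a competitor below \<open>m\<close>, so minimality turns
  sublinearity into additivity.
\<close>

lemma minimal_sublinear_linear:
  assumes m: "sublinear m"
    and min: "\<And>r. sublinear r \<Longrightarrow> (\<And>x. r x \<le> m x) \<Longrightarrow> r = m"
  shows "linear m"
proof -
  have superadd: "m x + m y \<le> m (x + y)" for x y
  proof -
    \<comment> \<open>\<open>r\<close> is the sublinear minorant of \<open>m\<close> forced to satisfy \<open>r (x) \<le> m (x + y) - m y\<close>;
      by minimality it equals \<open>m\<close>, and the bound with \<open>t = 1\<close> is superadditivity.\<close>
    define r where "r x = (INF t\<in>{0..}. m (x + t *\<^sub>R y) - t * m y)" for x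
    have bdd: "bdd_below ((\<lambda>t. m (x + t *\<^sub>R y) - t * m y) ` {0..})" for x
    proof (rule bdd_belowI2)
      fix t :: real assume "t \<in> {0..}"
      then have "t * m y = m (t *\<^sub>R y)" by (simp add: sublinear_scaleR[OF m])
      also have "\<dots> \<le> m (x + t *\<^sub>R y) + m (- x)"
        using sublinear_add[OF m, of "x + t *\<^sub>R y" "- x"] by simp
      finally show "- m (- x) \<le> m (x + t *\<^sub>R y) - t * m y" by simp
    qed
    have r_le: "r x \<le> m (x + t *\<^sub>R y) - t * m y" if "0 \<le> t" for t x
      unfolding r_def using cINF_lower[OF bdd] that by simp
    have r_ge: "c \<le> r x" if "\<And>t. 0 \<le> t \<Longrightarrow> c \<le> m (x + t *\<^sub>R y) - t * m y" for c x
      unfolding r_def by (rule cINF_greatest) (use that in auto)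
    have "r (u + v) \<le> r u + r v" for u v
    proof -
      have *: "r (u + v) \<le> (m (u + s *\<^sub>R y) - s * m y) + (m (v + t *\<^sub>R y) - t * m y)"
        if "0 \<le> s" "0 \<le> t" for s t
        using r_le[of "s + t" "u + v"] that
          sublinear_add[OF m, of "u + s *\<^sub>R y" "v + t *\<^sub>R y"] by (simp add: algebra_simps)
      have "r (u + v) - (m (v + t *\<^sub>R y) - t * m y) \<le> r u" if "0 \<le> t" for t
        by (rule r_ge) (use *[OF _ that] in \<open>simp add: algebra_simps\<close>)
      then have "r (u + v) - r u \<le> r v"
        by (intro r_ge) (simp add: algebra_simps)
      then show ?thesis by simp
    qed
    moreover have "r (s *\<^sub>R u) \<le> s * r u" if s: "0 < s" for s u
    proof -
      have "inverse s * r (s *\<^sub>R u) \<le> r u"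
      proof (rule r_ge)
        fix t :: real assume t: "0 \<le> t"
        have "r (s *\<^sub>R u) \<le> m (s *\<^sub>R (u + t *\<^sub>R y)) - (s * t) * m y"
          using r_le[of "s * t" "s *\<^sub>R u"] s t by (simp add: algebra_simps)
        also have "m (s *\<^sub>R (u + t *\<^sub>R y)) = s * m (u + t *\<^sub>R y)"
          using s by (intro sublinear_scaleR[OF m]) simp
        also have "s * m (u + t *\<^sub>R y) - (s * t) * m y = s * (m (u + t *\<^sub>R y) - t * m y)"
          by (simp add: algebra_simps)
        finally show "inverse s * r (s *\<^sub>R u) \<le> m (u + t *\<^sub>R y) - t * m y"
          using s by (simp add: field_simps)
      qed
      then show ?thesis using s by (simp add: field_simps)
    qed
    ultimately have "sublinear r" by (simp add: sublinear_def)
    then have "r = m" by (rule min) (use r_le[of 0] in simp)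
    then show ?thesis using r_le[of 1 x] by simp
  qed
  have add: "m (x + y) = m x + m y" for x y
    using superadd[of x y] sublinear_add[OF m, of x y] by simp
  have neg: "m (- x) = - m x" for x
    using add[of x "- x"] sublinear_zero[OF m] by simp
  have "m (t *\<^sub>R x) = t * m x" for t x
  proof (cases "0 \<le> t")
    case False
    then show ?thesis
      using sublinear_scaleR[OF m, of "- t" x] neg[of "t *\<^sub>R x"] by simp
  qed (simp add: sublinear_scaleR[OF m])
  then show ?thesis by (intro linearI) (auto simp: add)
qed

text \<open>
  Infima of chains of sublinear functions exist because \<open>- p (- x)\<close> bounds them
  below, so Zorn's lemma gives a minimal sublinear function under \<open>p\<close>, and minimal
  ones are linear.
\<close>

lemma sublinear_dominates_linear:
  fixes p :: "'a::real_vector \<Rightarrow> real"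
  assumes p: "sublinear p"
  obtains g where "linear g" "\<And>x. g x \<le> p x"
proof -
  define A where "A = {q. sublinear q \<and> (\<forall>x. q x \<le> p x)}"
  define P where "P = (\<lambda>f g :: 'a \<Rightarrow> real. \<forall>x. g x \<le> f x)"
  have "\<exists>m\<in>A. \<forall>a\<in>A. P m a \<longrightarrow> a = m"
  proof (rule predicate_Zorn)
    show "partial_order_on A (relation_of P A)"
      by (rule partial_order_on_relation_ofI)
        (auto simp: P_def fun_eq_iff intro: order_trans antisym)
  next
    fix C assume C: "C \<in> Chains (relation_of P A)"
    show "\<exists>u\<in>A. \<forall>a\<in>C. P a u"
    proof (cases "C = {}")
      case True
      then show ?thesis using p by (auto simp: A_def)
    next
      case False
      have sub: "sublinear q \<and> (\<forall>x. q x \<le> p x)" if "q \<in> C" for q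
        using C that by (auto simp: Chains_def relation_of_def A_def)
      have chain: "(\<forall>x. q x \<le> r x) \<or> (\<forall>x. r x \<le> q x)" if "q \<in> C" "r \<in> C" for q r
        using C that by (auto simp: Chains_def relation_of_def P_def)
      have bdd: "bdd_below ((\<lambda>q. q x) ` C)" for x
        by (rule chain_Inf_sublinear[OF False sub chain])
      have "sublinear (\<lambda>x. INF q\<in>C. q x)"
        by (rule chain_Inf_sublinear[OF False sub chain])
      moreover have le: "(INF q\<in>C. q x) \<le> q x" if "q \<in> C" for q x
        by (rule cINF_lower[OF bdd that])
      moreover have "(INF q\<in>C. q x) \<le> p x" for x
        using le sub False by (meson all_not_in_conv order_trans)
      ultimately show ?thesis
        by (auto simp: A_def P_def intro!: bexI[of _ "\<lambda>x. INF q\<in>C. q x"])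
    qed
  qed
  then obtain m where m: "sublinear m" "\<And>x. m x \<le> p x"
    and min: "\<And>r. sublinear r \<Longrightarrow> (\<forall>x. r x \<le> p x) \<Longrightarrow> (\<forall>x. r x \<le> m x) \<Longrightarrow> r = m"
    unfolding A_def P_def by blast
  have "linear m"
    by (rule minimal_sublinear_linear[OF m(1)], rule min) (use m order_trans in blast)+
  with m that show thesis by blast
qed

text \<open>
  The Hahn-Banach theorem, for a subspace given as the range of a linear map: the functional to
  be extended can then be given on the parameter space, which is \<open>l\<^sub>1\<close> in the
  application.
\<close>

lemma Hahn_Banach_along_linear:
  fixes J :: "'b::real_vector \<Rightarrow> 'a::real_normed_vector"
  assumes J: "linear J" and f: "linear f" and le: "\<And>b. f b \<le> norm (J b)"
  obtains \<psi> :: "'a \<Rightarrow>\<^sub>L real" where "norm \<psi> \<le> 1" "\<And>b. blinfun_apply \<psi> (J b) = f b"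
proof -
  \<comment> \<open>A linear minorant of \<open>p\<close> is dominated by the norm (\<open>b = 0\<close>) and by \<open>f\<close> along \<open>J\<close>
    (\<open>x = J b\<close>); linearity turns the second bound into an equality.\<close>
  define p where "p x = (INF b. norm (x - J b) + f b)" for x
  have bdd: "bdd_below (range (\<lambda>b. norm (x - J b) + f b))" for x
  proof (rule bdd_belowI2)
    fix b
    have "- f b \<le> norm (J b)" using le[of "- b"] by (simp add: linear_neg[OF f] linear_neg[OF J])
    then show "- norm x \<le> norm (x - J b) + f b"
      using norm_triangle_sub[of "J b" x] by (simp add: norm_minus_commute)
  qed
  have p_le: "p x \<le> norm (x - J b) + f b" for x b
    unfolding p_def by (rule cINF_lower[OF bdd]) simp
  have p_ge: "c \<le> p x" if "\<And>b. c \<le> norm (x - J b) + f b" for c x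
    unfolding p_def by (rule cINF_greatest) (use that in auto)
  have "sublinear p"
    unfolding sublinear_def
  proof (intro conjI allI impI)
    fix u v
    have *: "p (u + v) \<le> (norm (u - J b) + f b) + (norm (v - J c) + f c)" for b c
      using p_le[of "u + v" "b + c"] norm_triangle_ineq[of "u - J b" "v - J c"]
      by (simp add: linear_add[OF f] linear_add[OF J] algebra_simps)
    have "p (u + v) - (norm (v - J c) + f c) \<le> p u" for c
      by (rule p_ge) (use * in \<open>simp add: algebra_simps\<close>)
    then have "p (u + v) - p u \<le> p v"
      by (intro p_ge) (simp add: algebra_simps)
    then show "p (u + v) \<le> p u + p v" by simp
  next
    fix t :: real and u assume t: "0 < t"
    have "inverse t * p (t *\<^sub>R u) \<le> p u"
    proof (rule p_ge)
      fix b
      have "p (t *\<^sub>R u) \<le> norm (t *\<^sub>R (u - J b)) + t * f b"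
        using p_le[of "t *\<^sub>R u" "t *\<^sub>R b"]
        by (simp add: linear_scale[OF f] linear_scale[OF J] algebra_simps)
      also have "norm (t *\<^sub>R (u - J b)) = t * norm (u - J b)" using t by simp
      also have "t * norm (u - J b) + t * f b = t * (norm (u - J b) + f b)"
        by (simp add: algebra_simps)
      finally show "inverse t * p (t *\<^sub>R u) \<le> norm (u - J b) + f b"
        using t by (simp add: field_simps)
    qed
    then show "p (t *\<^sub>R u) \<le> t * p u" using t by (simp add: field_simps)
  qed
  then obtain g where g: "linear g" "\<And>x. g x \<le> p x"
    using sublinear_dominates_linear by blast
  have g_le: "g x \<le> norm x" for x
    using order_trans[OF g(2) p_le[of x 0]] by (simp add: linear_0[OF f] linear_0[OF J])
  have g_abs: "\<bar>g x\<bar> \<le> norm x" for x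
    using g_le[of x] g_le[of "- x"] by (simp add: linear_neg[OF g(1)] abs_le_iff)
  have gJ_le: "g (J b) \<le> f b" for b
    using order_trans[OF g(2) p_le[of "J b" b]] by simp
  have gJ: "g (J b) = f b" for b
    using gJ_le[of b] gJ_le[of "- b"]
    by (simp add: linear_neg[OF g(1)] linear_neg[OF f] linear_neg[OF J])
  have bl: "bounded_linear g"
    by (rule bounded_linear_intro[where K = 1])
      (use g_abs in \<open>auto simp: linear_add[OF g(1)] linear_scale[OF g(1)]\<close>)
  have "norm (Blinfun g) \<le> 1"
    by (rule norm_blinfun_bound) (use g_abs in \<open>auto simp: bounded_linear_Blinfun_apply[OF bl]\<close>)
  with gJ show thesis
    by (intro that[of "Blinfun g"]) (auto simp: bounded_linear_Blinfun_apply[OF bl])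
qed

section \<open>A criterion for the first Baire class\<close>

text \<open>
  Call an open set good if the separation is possible inside it. Countable unions of good sets
  are good, since every point can be decided by the first set that contains it, so by the
  Lindelof property there is a largest good set. On its complement one of \<open>A\<close> and
  \<open>B\<close> is absent from some relatively open piece, which could be added; so the
  complement is empty.
\<close>

lemma fsigma_gdelta_separation:
  assumes met: "metrizable_space X" and sc: "second_countable X"
    and scattered: "\<And>F. closedin X F \<Longrightarrow> F \<noteq> {} \<Longrightarrow>
      \<exists>W. openin X W \<and> W \<inter> F \<noteq> {} \<and> (W \<inter> F \<inter> A = {} \<or> W \<inter> F \<inter> B = {})"
  obtains D where "fsigma_in X D" "fsigma_in X (topspace X - D)"
    "A \<inter> topspace X \<subseteq> D" "D \<inter> B = {}"
proof -
  define sep where "sep U D \<longleftrightarrow> D \<subseteq> U \<and> fsigma_in X D \<and> fsigma_in X (U - D) \<and>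
    A \<inter> U \<subseteq> D \<and> D \<inter> B = {}" for U D
  define good where "good U \<longleftrightarrow> openin X U \<and> (\<exists>D. sep U D)" for U
  have fs_open: "fsigma_in X U" if "openin X U" for U
    using met that open_imp_fsigma_in by blast
  have fs_diff: "fsigma_in X (S - U)" if "fsigma_in X S" "openin X U" for S U
    using that fsigma_in_diff open_imp_gdelta_in by blast
  have good_empty: "good {}"
    by (auto simp: good_def sep_def)
  have good_subset: "good U" if W: "good W" and U: "openin X U" "U \<subseteq> W" for U W
  proof -
    obtain D where D: "sep W D" using W unfolding good_def by blast
    have "U - D \<inter> U = (W - D) \<inter> U" using U by blast
    then have "sep U (D \<inter> U)"
      using D U fs_open[OF U(1)] unfolding sep_def
      by (auto intro: fsigma_in_Int)
    then show ?thesis using U(1) by (auto simp: good_def)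
  qed
  have good_seq: "good (\<Union>n. U n)" if U: "\<And>n::nat. good (U n)" for U
  proof -
    obtain D where D: "\<And>n. sep (U n) (D n)"
      using U unfolding good_def by metis
    define V where "V n = (\<Union>m<n. U m)" for n
    have V: "openin X (V n)" for n using U by (auto simp: V_def good_def)
    define E where "E = (\<Union>n. D n - V n)"
    have DU: "D n \<subseteq> U n" for n using D by (simp add: sep_def)
    have first: "\<exists>n. x \<in> U n - V n" if "x \<in> (\<Union>n. U n)" for x
    proof -
      have "x \<in> U (LEAST n. x \<in> U n)" using that by (auto intro: LeastI)
      moreover have "x \<notin> V (LEAST n. x \<in> U n)"
        by (auto simp: V_def dest: not_less_Least)
      ultimately show ?thesis by blast
    qed
    have unique: "m = n" if "x \<in> U n - V n" "x \<in> U m - V m" for x m n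
      using that by (cases m n rule: linorder_cases) (auto simp: V_def)
    have diff: "(\<Union>n. U n) - E = (\<Union>n. (U n - D n) - V n)"
    proof safe
      fix x n assume "x \<in> U n" "x \<notin> E"
      then obtain k where "x \<in> U k - V k" using first by blast
      then show "x \<in> (\<Union>n. (U n - D n) - V n)"
        using \<open>x \<notin> E\<close> by (auto simp: E_def)
    next
      fix x n assume x: "x \<in> U n" "x \<notin> D n" "x \<notin> V n" "x \<in> E"
      then obtain k where "x \<in> D k" "x \<notin> V k" by (auto simp: E_def)
      then show False using x unique[of x n k] DU by blast
    qed auto
    have "sep (\<Union>n. U n) E"
      unfolding sep_def
    proof (intro conjI)
      show "E \<subseteq> (\<Union>n. U n)" using DU by (auto simp: E_def)
      show "fsigma_in X E"
        unfolding E_def using D V fs_diff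
        by (intro fsigma_in_Union) (auto simp: sep_def)
      show "fsigma_in X ((\<Union>n. U n) - E)"
        unfolding diff using D V fs_diff
        by (intro fsigma_in_Union) (auto simp: sep_def)
      show "A \<inter> (\<Union>n. U n) \<subseteq> E"
      proof
        fix x assume x: "x \<in> A \<inter> (\<Union>n. U n)"
        then obtain k where "x \<in> U k - V k" using first by blast
        then show "x \<in> E" using x D[of k] by (auto simp: E_def sep_def)
      qed
      show "E \<inter> B = {}" using D by (auto simp: E_def sep_def)
    qed
    then show ?thesis using U by (auto simp: good_def)
  qed
  define W where "W = \<Union>(Collect good)"
  have openW: "openin X W" by (auto simp: W_def good_def)
  have "Lindelof_space (subtopology X W)"
    using sc second_countable_subtopology second_countable_imp_Lindelof_space by blast
  then have "\<exists>\<V>. countable \<V> \<and> \<V> \<subseteq> Collect good \<and> W \<subseteq> \<Union>\<V>"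
    using openin_subset[OF openW] unfolding Lindelof_space_subtopology_subset[OF openin_subset[OF openW]]
    by (auto simp: W_def good_def)
  then obtain \<V> where \<V>: "countable \<V>" "\<V> \<subseteq> Collect good" "W \<subseteq> \<Union>\<V>" by blast
  then have WV: "W = \<Union>(insert {} \<V>)" by (auto simp: W_def)
  obtain U :: "nat \<Rightarrow> _" where U: "range U = insert {} \<V>"
    using \<V>(1) by (metis countable_insert insert_not_empty range_from_nat_into)
  have "good (U n)" for n
  proof -
    have "U n \<in> insert {} \<V>" using U by (metis rangeI)
    then show ?thesis using \<V>(2) good_empty by auto
  qed
  then have "good (\<Union>n. U n)" by (rule good_seq)
  then have goodW: "good W" by (simp only: U WV)
  have "W = topspace X"
  proof (rule ccontr)
    assume "W \<noteq> topspace X"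
    define F where "F = topspace X - W"
    have F: "closedin X F" "F \<noteq> {}"
      using openW \<open>W \<noteq> topspace X\<close> openin_subset[OF openW] by (auto simp: F_def)
    obtain O' where O': "openin X O'" "O' \<inter> F \<noteq> {}"
      and AB: "O' \<inter> F \<inter> A = {} \<or> O' \<inter> F \<inter> B = {}"
      using scattered[OF F] by blast
    have O'W: "O' \<inter> F = O' - W" using openin_subset[OF O'(1)] by (auto simp: F_def)
    obtain D where D: "sep W D" using goodW by (auto simp: good_def)
    have fsO: "fsigma_in X (O' - W)" using fs_diff fs_open openW O'(1) by blast
    have "\<exists>D. sep (W \<union> O') D"
    proof (cases "O' \<inter> F \<inter> A = {}")
      case True
      have "(W \<union> O') - D = (W - D) \<union> (O' - W)" using D by (auto simp: sep_def)
      then have "sep (W \<union> O') D"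
        using D True fsO unfolding sep_def O'W by (auto intro: fsigma_in_Un)
      then show ?thesis by blast
    next
      case False
      then have B: "O' \<inter> F \<inter> B = {}" using AB by blast
      have "(W \<union> O') - (D \<union> (O' - W)) = W - D" by blast
      then have "sep (W \<union> O') (D \<union> (O' - W))"
        using D B fsO unfolding sep_def O'W by (auto intro: fsigma_in_Un)
      then show ?thesis by blast
    qed
    then have "good (W \<union> O')" using openW O'(1) by (auto simp: good_def)
    then have "O' \<subseteq> W" by (auto simp: W_def)
    then show False using O'(2) by (auto simp: F_def)
  qed
  then obtain D where "sep (topspace X) D" using goodW by (auto simp: good_def)
  then show thesis using that by (auto simp: sep_def)
qed

text \<open>
  The functions whose restriction to the space lies in \<open>Baire_class_1\<close>. Sums and
  multiples preserve this property, but they do not preserve extensionality.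
\<close>

definition limit_of_continuous :: "'b topology \<Rightarrow> ('b \<Rightarrow> real) \<Rightarrow> bool"
  where "limit_of_continuous X f \<longleftrightarrow>
    (\<exists>g. (\<forall>n::nat. continuous_map X euclideanreal (g n)) \<and>
         (\<forall>x\<in>topspace X. (\<lambda>n. g n x) \<longlonglongrightarrow> f x))"

text \<open>
  If \<open>D\<close> and its complement are increasing unions of closed sets, Urysohn functions
  that are 1 on the \<open>n\<close>-th piece of \<open>D\<close> and 0 on the
  \<open>n\<close>-th piece of the complement are eventually correct at every point.
\<close>

lemma limit_of_continuous_indicator:
  assumes met: "metrizable_space X" and "fsigma_in X D" "fsigma_in X (topspace X - D)"
  shows "limit_of_continuous X (indicator D)"
proof -
  obtain C where C: "\<And>n. closedin X (C n)" "\<And>n. C n \<subseteq> C (Suc n)" "\<Union>(range C) = D"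
    using assms(2) unfolding fsigma_in_ascending by blast
  obtain E where E: "\<And>n. closedin X (E n)" "\<And>n. E n \<subseteq> E (Suc n)" "\<Union>(range E) = topspace X - D"
    using assms(3) unfolding fsigma_in_ascending by blast
  have monoC: "C m \<subseteq> C n" if "m \<le> n" for m n
    using lift_Suc_mono_le[of C, OF C(2) that] .
  have monoE: "E m \<subseteq> E n" if "m \<le> n" for m n
    using lift_Suc_mono_le[of E, OF E(2) that] .
  have "\<exists>f. continuous_map X euclideanreal f \<and> f ` C n \<subseteq> {1} \<and> f ` E n \<subseteq> {0}" for n
  proof -
    have "disjnt (C n) (E n)" using C(3) E(3) by (fastforce simp: disjnt_def)
    then obtain f where "continuous_map X euclideanreal f" "f ` C n \<subseteq> {1}" "f ` E n \<subseteq> {0}"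
      using Urysohn_lemma_alt[OF metrizable_imp_normal_space[OF met] C(1) E(1)] by metis
    then show ?thesis by blast
  qed
  then obtain g where g: "\<And>n. continuous_map X euclideanreal (g n)"
    "\<And>n. g n ` C n \<subseteq> {1}" "\<And>n. g n ` E n \<subseteq> {0}" by metis
  have "(\<lambda>n. g n x) \<longlonglongrightarrow> indicator D x" if x: "x \<in> topspace X" for x
  proof (cases "x \<in> D")
    case True
    then obtain m where "x \<in> C m" using C(3) by blast
    then have "\<forall>n\<ge>m. g n x = 1" using g(2) monoC by blast
    then have "eventually (\<lambda>n. g n x = 1) sequentially" using eventually_sequentially by blast
    then show ?thesis using True by (simp add: tendsto_eventually)
  next
    case False
    then obtain m where "x \<in> E m" using E(3) x by blast
    then have "\<forall>n\<ge>m. g n x = 0" using g(3) monoE by blast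
    then have "eventually (\<lambda>n. g n x = 0) sequentially" using eventually_sequentially by blast
    then show ?thesis using False by (simp add: tendsto_eventually)
  qed
  then show ?thesis using g(1) by (auto simp: limit_of_continuous_def)
qed

lemma limit_of_continuous_const: "limit_of_continuous X (\<lambda>x. c)"
  unfolding limit_of_continuous_def by (rule exI[of _ "\<lambda>n x. c"]) simp

lemma limit_of_continuous_add:
  assumes "limit_of_continuous X f" "limit_of_continuous X g"
  shows "limit_of_continuous X (\<lambda>x. f x + g x)"
proof -
  obtain F G where "\<And>n. continuous_map X euclideanreal (F n)" "\<And>x. x \<in> topspace X \<Longrightarrow> (\<lambda>n. F n x) \<longlonglongrightarrow> f x"
    "\<And>n. continuous_map X euclideanreal (G n)" "\<And>x. x \<in> topspace X \<Longrightarrow> (\<lambda>n. G n x) \<longlonglongrightarrow> g x"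
    using assms unfolding limit_of_continuous_def by metis
  then show ?thesis
    unfolding limit_of_continuous_def
    by (intro exI[of _ "\<lambda>n x. F n x + G n x"]) (auto intro!: continuous_map_add tendsto_add)
qed

lemma limit_of_continuous_cmult:
  assumes "limit_of_continuous X f"
  shows "limit_of_continuous X (\<lambda>x. c * f x)"
proof -
  obtain F where "\<And>n. continuous_map X euclideanreal (F n)" "\<And>x. x \<in> topspace X \<Longrightarrow> (\<lambda>n. F n x) \<longlonglongrightarrow> f x"
    using assms unfolding limit_of_continuous_def by metis
  then show ?thesis
    unfolding limit_of_continuous_def
    by (intro exI[of _ "\<lambda>n x. c * F n x"]) (auto intro!: continuous_map_real_mult_left tendsto_mult_left)
qed

lemma limit_of_continuous_sum:
  assumes "finite I" "\<And>i. i \<in> I \<Longrightarrow> limit_of_continuous X (f i)"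
  shows "limit_of_continuous X (\<lambda>x. \<Sum>i\<in>I. f i x)"
  using assms
  by (induction I) (auto intro: limit_of_continuous_add limit_of_continuous_const)

lemma limit_of_continuous_uniform_limit:
  assumes approx: "\<And>e. 0 < e \<Longrightarrow>
    \<exists>h. limit_of_continuous X h \<and> (\<forall>x\<in>topspace X. \<bar>f x - h x\<bar> \<le> e)"
  shows "limit_of_continuous X f"
proof -
  have "\<exists>h. limit_of_continuous X h \<and> (\<forall>x\<in>topspace X. \<bar>f x - h x\<bar> \<le> (1/2)^k)" for k :: nat
    by (rule approx) simp
  then obtain h where h: "\<And>k. limit_of_continuous X (h k)"
    "\<And>k x. x \<in> topspace X \<Longrightarrow> \<bar>f x - h k x\<bar> \<le> (1/2)^k"
    by metis
  then obtain g where g: "\<And>k n. continuous_map X euclideanreal (g k n)"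
    "\<And>k x. x \<in> topspace X \<Longrightarrow> (\<lambda>n. g k n x) \<longlonglongrightarrow> h k x"
    unfolding limit_of_continuous_def by metis
  \<comment> \<open>\<open>f = h 0 + (\<Sum>k. h (Suc k) - h k)\<close>, and the continuous approximants of the increments may
    be clipped to their bounds \<open>B k\<close>, so that limit and sum can be exchanged.\<close>
  define B where "B k = 2 * (1/2::real)^k" for k
  have B0: "0 \<le> B k" for k by (simp add: B_def)
  define a where "a k n x = max (- B k) (min (B k) (g (Suc k) n x - g k n x))" for k n x
  define G where "G n x = g 0 n x + (\<Sum>k<n. a k n x)" for n x
  have "continuous_map X euclideanreal (G n)" for n
    unfolding G_def a_def
    by (intro continuous_map_add continuous_map_sum continuous_map_real_max continuous_map_real_min
        continuous_map_diff g(1) continuous_map_canonical_const) auto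
  moreover have "(\<lambda>n. G n x) \<longlonglongrightarrow> f x" if x: "x \<in> topspace X" for x
  proof -
    define d where "d k = h (Suc k) x - h k x" for k
    have d: "\<bar>d k\<bar> \<le> B k" for k
    proof -
      have "\<bar>d k\<bar> \<le> (1/2)^Suc k + (1/2)^k"
        using h(2)[OF x, of k] h(2)[OF x, of "Suc k"] unfolding d_def by linarith
      also have "\<dots> \<le> B k" by (simp add: B_def)
      finally show ?thesis .
    qed
    have clip: "max (- B k) (min (B k) (d k)) = d k" for k
      using d[of k] by (auto simp: abs_le_iff)
    have lim_a: "(\<lambda>n. a k n x) \<longlonglongrightarrow> d k" for k
    proof -
      have "(\<lambda>n. a k n x) \<longlonglongrightarrow> max (- B k) (min (B k) (h (Suc k) x - h k x))"
        unfolding a_def by (intro tendsto_max tendsto_min tendsto_diff tendsto_const g(2) x)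
      then show ?thesis using clip[of k] by (simp add: d_def)
    qed
    define c where "c k n = (if k < n then a k n x else 0)" for k n
    have "eventually (\<lambda>n. a k n x = c k n) sequentially" for k
      using eventually_gt_at_top[of k] by eventually_elim (simp add: c_def)
    then have lim_c: "(\<lambda>n. c k n) \<longlonglongrightarrow> d k" for k
      using lim_a[of k] by (rule Lim_transform_eventually[rotated])
    have c_bound: "norm (c k n) \<le> B k" for k n
      using B0[of k] by (auto simp: c_def a_def abs_le_iff)
    have "summable B"
      unfolding B_def by (intro summable_mult summable_geometric) simp
    have "\<forall>\<^sub>F (k, n) in at_top \<times>\<^sub>F sequentially. norm (c k n) \<le> B k"
      by (rule always_eventually) (use c_bound in auto)
    then have "(\<lambda>n. suminf (\<lambda>k. c k n)) \<longlonglongrightarrow> suminf d"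
      using tannerys_theorem[of c d sequentially B, OF lim_c _ \<open>summable B\<close>] by simp
    moreover have "suminf (\<lambda>k. c k n) = (\<Sum>k<n. a k n x)" for n
    proof -
      have "suminf (\<lambda>k. c k n) = (\<Sum>k<n. c k n)"
        by (rule suminf_finite) (auto simp: c_def)
      then show ?thesis by (simp add: c_def)
    qed
    ultimately have sum_lim: "(\<lambda>n. \<Sum>k<n. a k n x) \<longlonglongrightarrow> suminf d" by simp
    have "(\<lambda>k. f x - h k x) \<longlonglongrightarrow> 0"
    proof (rule Lim_null_comparison)
      show "(\<lambda>k. (1/2::real)^k) \<longlonglongrightarrow> 0" by (rule LIMSEQ_power_zero) simp
      show "\<forall>\<^sub>F k in sequentially. norm (f x - h k x) \<le> (1/2)^k" using h(2)[OF x] by simp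
    qed
    then have "(\<lambda>k. f x - (f x - h k x)) \<longlonglongrightarrow> f x - 0" by (intro tendsto_diff tendsto_const)
    then have "(\<lambda>k. h k x) \<longlonglongrightarrow> f x" by simp
    then have "d sums (f x - h 0 x)" unfolding d_def by (rule telescope_sums)
    then have "suminf d = f x - h 0 x" by (rule sums_unique[symmetric])
    then have "(\<lambda>n. G n x) \<longlonglongrightarrow> h 0 x + (f x - h 0 x)"
      unfolding G_def using sum_lim g(2)[OF x, of 0] by (intro tendsto_add) auto
    then show ?thesis by simp
  qed
  ultimately show ?thesis unfolding limit_of_continuous_def by blast
qed

text \<open>
  The direction of Baire's characterization theorem that produces continuous functions.
  Separating the level sets for finitely many thresholds gives step functions that approximate
  \<open>f\<close> uniformly, and each step is a limit of continuous functions.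
\<close>

lemma no_oscillation_imp_limit_of_continuous:
  assumes met: "metrizable_space X" and sc: "second_countable X"
    and bounded: "\<And>x. x \<in> topspace X \<Longrightarrow> \<bar>f x\<bar> \<le> M"
    and no_oscillation: "\<And>F a b. a < b \<Longrightarrow> closedin X F \<Longrightarrow> F \<noteq> {} \<Longrightarrow>
      \<exists>W. openin X W \<and> W \<inter> F \<noteq> {} \<and> (W \<inter> F \<inter> {x. f x \<le> a} = {} \<or> W \<inter> F \<inter> {x. b \<le> f x} = {})"
  shows "limit_of_continuous X f"
proof (rule limit_of_continuous_uniform_limit)
  fix e :: real assume e: "0 < e"
  define c where "c k = - M + real k * e" for k
  have "\<exists>C. limit_of_continuous X (indicator C) \<and>
      (\<forall>x\<in>topspace X. (c (Suc k) \<le> f x \<longrightarrow> x \<in> C) \<and> (f x \<le> c k \<longrightarrow> x \<notin> C))" for k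
  proof -
    have lt: "c k < c (Suc k)" using e by (simp add: c_def algebra_simps)
    obtain D where D: "fsigma_in X D" "fsigma_in X (topspace X - D)"
      "{x. c (Suc k) \<le> f x} \<inter> topspace X \<subseteq> D" "D \<inter> {x. f x \<le> c k} = {}"
      using fsigma_gdelta_separation[OF met sc, of "{x. c (Suc k) \<le> f x}" "{x. f x \<le> c k}"]
        no_oscillation[OF lt] by (metis (no_types, lifting))
    then show ?thesis
      using limit_of_continuous_indicator[OF met D(1,2)] by blast
  qed
  then obtain C where C: "\<And>k. limit_of_continuous X (indicator (C k))"
    "\<And>k x. x \<in> topspace X \<Longrightarrow> c (Suc k) \<le> f x \<Longrightarrow> x \<in> C k"
    "\<And>k x. x \<in> topspace X \<Longrightarrow> f x \<le> c k \<Longrightarrow> x \<notin> C k"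
    by metis
  obtain K :: nat where K: "2 * M / e < real K" using reals_Archimedean2 by blast
  \<comment> \<open>Counting the thresholds passed by \<open>f x\<close> recovers \<open>f x\<close> up to one step \<open>e\<close>.\<close>
  define h where "h x = - M + e * (\<Sum>k<K. indicator (C k) x)" for x
  have "limit_of_continuous X h"
    unfolding h_def
    by (intro limit_of_continuous_add limit_of_continuous_const limit_of_continuous_cmult
        limit_of_continuous_sum C(1)) simp
  moreover have "\<bar>f x - h x\<bar> \<le> e" if x: "x \<in> topspace X" for x
  proof -
    define j where "j = nat \<lfloor>(f x + M) / e\<rfloor>"
    have pos: "0 \<le> (f x + M) / e" using bounded[OF x] e by (simp add: abs_le_iff)
    then have j: "real j \<le> (f x + M) / e" "(f x + M) / e < real j + 1"
      by (auto simp: j_def)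
    have cj: "c j \<le> f x" "f x < c (Suc j)"
      using j e by (auto simp: c_def field_simps)
    have "(f x + M) / e \<le> 2 * M / e"
      using bounded[OF x] e by (intro divide_right_mono) auto
    then have jK: "j < K" using j(1) K by linarith
    have mono: "c m \<le> c n" if "m \<le> n" for m n using that e by (simp add: c_def)
    have in_C: "x \<in> C k" if "k < j" for k
      using C(2)[OF x] cj(1) mono[of "Suc k" j] that by simp
    have notin_C: "x \<notin> C k" if "j < k" for k
      using C(3)[OF x] cj(2) mono[of "Suc j" k] that by simp
    have "(\<Sum>k<K. indicator (C k) x :: real) = real j + indicator (C j) x"
    proof -
      have "(\<Sum>k<K. indicator (C k) x :: real) = (\<Sum>k<Suc j. indicator (C k) x)"
        by (rule sum.mono_neutral_right) (use jK notin_C in \<open>auto simp: indicator_def\<close>)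
      also have "\<dots> = (\<Sum>k<j. indicator (C k) x) + indicator (C j) x" by simp
      also have "(\<Sum>k<j. indicator (C k) x :: real) = (\<Sum>k<j. 1)"
        by (rule sum.cong) (use in_C in auto)
      finally show ?thesis by simp
    qed
    then have "h x = c j + e * indicator (C j) x" by (simp add: h_def c_def algebra_simps)
    moreover have "c (Suc j) = c j + e" by (simp add: c_def algebra_simps)
    ultimately show ?thesis
      using cj e by (cases "x \<in> C j") (simp_all add: abs_le_iff)
  qed
  ultimately show "\<exists>h. limit_of_continuous X h \<and> (\<forall>x\<in>topspace X. \<bar>f x - h x\<bar> \<le> e)" by blast
qed

section \<open>Independent sequences and copies of \<open>l\<^sub>1\<close>\<close>

text \<open>
  The core of Rosenthal's dichotomy: \<open>f\<close> lies in the pointwise closure of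
  \<open>S\<close> and oscillates everywhere on \<open>F\<close>. Whenever the functions chosen
  so far realize all patterns, each pattern is realized at a point where \<open>f\<close> is
  small and at a point where \<open>f\<close> is large; a member of \<open>S\<close> that is
  close to \<open>f\<close> at all these points can be chosen next.
\<close>

lemma oscillation_imp_independent_sequence:
  fixes S :: "('b \<Rightarrow> real) set"
  assumes cont: "\<And>h. h \<in> S \<Longrightarrow> continuous_map X euclideanreal h"
    and approx: "\<And>P e. finite P \<Longrightarrow> P \<subseteq> topspace X \<Longrightarrow> 0 < e \<Longrightarrow> \<exists>h\<in>S. \<forall>x\<in>P. \<bar>h x - f x\<bar> < e"
    and F: "F \<subseteq> topspace X" "F \<noteq> {}"
    and dense: "\<And>W. openin X W \<Longrightarrow> W \<inter> F \<noteq> {} \<Longrightarrow>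
      (\<exists>x\<in>W \<inter> F. f x \<le> a) \<and> (\<exists>x\<in>W \<inter> F. b \<le> f x)"
    and "a < a'" "a' < b'" "b' < b"
  obtains h :: "nat \<Rightarrow> 'b \<Rightarrow> real" where "\<And>n. h n \<in> S"
    "\<And>n I. \<exists>x\<in>F. \<forall>i<n. if i \<in> I then b' < h i x else h i x < a'"
proof -
  define indep where "indep n hs \<longleftrightarrow> (\<forall>i<n. hs i \<in> S) \<and>
    (\<forall>I. \<exists>x\<in>F. \<forall>i<n. if i \<in> I then b' < hs i x else hs i x < a')"
    for n and hs :: "nat \<Rightarrow> 'b \<Rightarrow> real"
  have "\<exists>s. \<forall>n. indep n (s n) \<and> (\<forall>i<n. s (Suc n) i = s n i)"
  proof (rule dependent_nat_choice)
    show "\<exists>hs. indep 0 hs" using F(2) by (auto simp: indep_def)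
  next
    fix hs :: "nat \<Rightarrow> 'b \<Rightarrow> real" and n
    assume hs: "indep n hs"
    define U where "U I = {x \<in> topspace X. \<forall>i\<in>{..<n}. hs i x \<in> (if i \<in> I then {b'<..} else {..<a'})}" for I
    have U: "openin X (U I)" for I
    proof -
      have "openin X (topspace X \<inter> (\<Inter>i\<in>{..<n}. {x \<in> topspace X. hs i x \<in> (if i \<in> I then {b'<..} else {..<a'})}))"
        by (intro openin_Int_Inter openin_continuous_map_preimage[OF cont])
          (use hs in \<open>auto simp: indep_def openin_continuous_map_preimage[OF cont]\<close>)
      moreover have "U I = topspace X \<inter> (\<Inter>i\<in>{..<n}. {x \<in> topspace X. hs i x \<in> (if i \<in> I then {b'<..} else {..<a'})})"
        by (fastforce simp: U_def)
      ultimately show ?thesis by simp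
    qed
    have "U I \<inter> F \<noteq> {}" for I
    proof -
      obtain x where x: "x \<in> F" "\<forall>i<n. if i \<in> I then b' < hs i x else hs i x < a'"
        using hs unfolding indep_def by blast
      then have "x \<in> U I" using F(1) by (auto simp: U_def)
      with x(1) show ?thesis by blast
    qed
    then have "\<forall>I. \<exists>x y. x \<in> U I \<inter> F \<and> f x \<le> a \<and> y \<in> U I \<inter> F \<and> b \<le> f y"
      using dense[OF U] by blast
    \<comment> \<open>Every cell of the current partition contains points of both kinds, so one function close
      to \<open>f\<close> at these finitely many points splits all cells.\<close>
    then obtain lo hi where lo: "\<And>I. lo I \<in> U I \<inter> F" "\<And>I. f (lo I) \<le> a"
      and hi: "\<And>I. hi I \<in> U I \<inter> F" "\<And>I. b \<le> f (hi I)"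
      by metis
    define P where "P = lo ` Pow {..<n} \<union> hi ` Pow {..<n}"
    have "finite P" "P \<subseteq> topspace X" using lo(1) hi(1) F(1) by (auto simp: P_def)
    then obtain h where h: "h \<in> S" "\<And>x. x \<in> P \<Longrightarrow> \<bar>h x - f x\<bar> < min (a' - a) (b - b')"
      using approx[of P "min (a' - a) (b - b')"] \<open>a < a'\<close> \<open>b' < b\<close> by auto
    define hs' where "hs' = hs(n := h)"
    have "\<exists>x\<in>F. \<forall>i<Suc n. if i \<in> I then b' < hs' i x else hs' i x < a'" for I
    proof -
      define K where "K = I \<inter> {..<n}"
      have mem: "i \<in> K \<longleftrightarrow> i \<in> I" if "i < n" for i using that by (simp add: K_def)
      define x where "x = (if n \<in> I then hi K else lo K)"
      have "x \<in> P" "x \<in> U K \<inter> F"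
        using lo(1) hi(1) by (auto simp: x_def P_def K_def)
      have "if n \<in> I then b' < h x else h x < a'"
        using h(2)[OF \<open>x \<in> P\<close>] lo(2)[of K] hi(2)[of K] by (auto simp: x_def abs_less_iff)
      moreover have "\<forall>i<n. if i \<in> I then b' < hs i x else hs i x < a'"
        using \<open>x \<in> U K \<inter> F\<close> mem by (auto simp: U_def split: if_splits)
      ultimately show ?thesis
        using \<open>x \<in> U K \<inter> F\<close> unfolding All_less_Suc by (intro bexI[of _ x]) (auto simp: hs'_def)
    qed
    moreover have "\<forall>i<Suc n. hs' i \<in> S"
      using hs h(1) by (auto simp: indep_def hs'_def less_Suc_eq)
    ultimately have "indep (Suc n) hs'"
      unfolding indep_def by blast
    then show "\<exists>hs'. indep (Suc n) hs' \<and> (\<forall>i<n. hs' i = hs i)"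
      by (intro exI[of _ hs']) (simp add: hs'_def)
  qed
  then obtain s where s: "\<And>n. indep n (s n)" "\<And>n i. i < n \<Longrightarrow> s (Suc n) i = s n i"
    by blast
  define h where "h i = s (Suc i) i" for i
  have s_eq: "s n i = h i" if "i < n" for n i
    using that
  proof (induction n)
    case (Suc n)
    then show ?case
      by (cases "i = n") (auto simp: h_def s(2))
  qed simp
  show thesis
  proof
    show "h n \<in> S" for n using s(1)[of "Suc n"] by (auto simp: indep_def h_def)
    show "\<exists>x\<in>F. \<forall>i<n. if i \<in> I then b' < h i x else h i x < a'" for n I
    proof -
      obtain x where "x \<in> F" "\<forall>i<n. if i \<in> I then b' < s n i x else s n i x < a'"
        using s(1)[of n] unfolding indep_def by blast
      then show ?thesis using s_eq by (intro bexI[of _ x]) auto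
    qed
  qed
qed

text \<open>
  Independence on the dual ball yields the lower \<open>l\<^sub>1\<close>-estimate, because two
  functionals with opposite sign patterns separate every coefficient in the right direction.
\<close>

lemma independent_lower_bound:
  fixes v :: "nat \<Rightarrow> 'a::real_normed_vector"
  assumes ball: "F \<subseteq> cball (0 :: 'a \<Rightarrow>\<^sub>L real) 1"
    and indep: "\<And>I. \<exists>\<phi>\<in>F. \<forall>i<n. if i \<in> I then b' < blinfun_apply \<phi> (v i) else blinfun_apply \<phi> (v i) < a'"
    and "a' \<le> b'"
  shows "(b' - a') / 2 * (\<Sum>i<n. \<bar>c i\<bar>) \<le> norm (\<Sum>i<n. c i *\<^sub>R v i)"
proof -
  obtain \<phi> where \<phi>: "\<phi> \<in> F" "\<And>i. i < n \<Longrightarrow> if 0 \<le> c i then b' < blinfun_apply \<phi> (v i) else blinfun_apply \<phi> (v i) < a'"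
    using indep[of "{i. 0 \<le> c i}"] by auto
  obtain \<psi> where \<psi>: "\<psi> \<in> F" "\<And>i. i < n \<Longrightarrow> if c i < 0 then b' < blinfun_apply \<psi> (v i) else blinfun_apply \<psi> (v i) < a'"
    using indep[of "{i. c i < 0}"] by auto
  \<comment> \<open>\<open>\<phi>\<close> is large where \<open>c\<close> is nonnegative and small elsewhere, \<open>\<psi>\<close> the other way round, so no
    term of \<open>(\<phi> - \<psi>) ?w\<close> is cancelled.\<close>
  let ?w = "\<Sum>i<n. c i *\<^sub>R v i"
  have "(b' - a') * (\<Sum>i<n. \<bar>c i\<bar>) = (\<Sum>i<n. (b' - a') * \<bar>c i\<bar>)"
    by (simp add: sum_distrib_left)
  also have "\<dots> \<le> (\<Sum>i<n. c i * (blinfun_apply \<phi> (v i) - blinfun_apply \<psi> (v i)))"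
  proof (rule sum_mono)
    fix i assume "i \<in> {..<n}"
    then have i: "i < n" by simp
    show "(b' - a') * \<bar>c i\<bar> \<le> c i * (blinfun_apply \<phi> (v i) - blinfun_apply \<psi> (v i))"
    proof (cases "0 \<le> c i")
      case True
      then have "b' - a' \<le> blinfun_apply \<phi> (v i) - blinfun_apply \<psi> (v i)"
        using \<phi>(2)[OF i] \<psi>(2)[OF i] by simp
      then show ?thesis using True by (simp add: mult.commute mult_left_mono)
    next
      case False
      then have "b' - a' \<le> blinfun_apply \<psi> (v i) - blinfun_apply \<phi> (v i)"
        using \<phi>(2)[OF i] \<psi>(2)[OF i] by simp
      then have "(- c i) * (b' - a') \<le> (- c i) * (blinfun_apply \<psi> (v i) - blinfun_apply \<phi> (v i))"
        using False by (intro mult_left_mono) auto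
      then show ?thesis using False by (simp add: algebra_simps)
    qed
  qed
  also have "\<dots> = blinfun_apply (\<phi> - \<psi>) ?w"
    by (simp add: blinfun.sum_right blinfun.scaleR_right blinfun.diff_left sum_subtractf algebra_simps)
  also have "\<dots> \<le> norm (\<phi> - \<psi>) * norm ?w"
    using norm_blinfun[of "\<phi> - \<psi>" ?w] by simp
  also have "\<dots> \<le> 2 * norm ?w"
  proof (rule mult_right_mono)
    have "norm \<phi> \<le> 1" "norm \<psi> \<le> 1" using ball \<phi>(1) \<psi>(1) by auto
    then show "norm (\<phi> - \<psi>) \<le> 2" using norm_triangle_ineq4[of \<phi> \<psi>] by simp
  qed simp
  finally show ?thesis by simp
qed

lemma norm_l1_nth: "norm a = (\<Sum>n. \<bar>l1_nth a n\<bar>)"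
  by (simp add: norm_l1.rep_eq)

lemma summable_l1_nth: "summable (\<lambda>n. \<bar>l1_nth a n\<bar>)"
  using l1_nth[of a] by simp

text \<open>
  The embedding is \<open>a \<mapsto> (\<Sum>n. a n *\<^sub>R v n)\<close>; the lower estimate
  passes from finite sums to the limit.
\<close>

lemma l1_basis_imp_copy:
  fixes v :: "nat \<Rightarrow> 'a::banach"
  assumes bounded: "\<And>n. norm (v n) \<le> M" and "0 < \<delta>"
    and lower: "\<And>n c. \<delta> * (\<Sum>i<n. \<bar>c i\<bar>) \<le> norm (\<Sum>i<n. c i *\<^sub>R v i)"
  shows "contains_isomorphic_copy_of_l1 (V :: 'a itself)"
proof -
  define J where "J a = (\<Sum>n. l1_nth a n *\<^sub>R v n)" for a
  have M0: "0 \<le> M" using bounded[of 0] norm_ge_zero order_trans by blast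
  have le: "norm (l1_nth a n *\<^sub>R v n) \<le> \<bar>l1_nth a n\<bar> * M" for a n
    using bounded[of n] by (simp add: mult_left_mono)
  have sum_norm: "summable (\<lambda>n. norm (l1_nth a n *\<^sub>R v n))" for a
    by (rule summable_comparison_test'[OF summable_mult2[OF summable_l1_nth[of a], of M]])
      (use le in auto)
  have sums: "summable (\<lambda>n. l1_nth a n *\<^sub>R v n)" for a
    by (rule summable_norm_cancel[OF sum_norm])
  have lin: "linear J"
  proof (rule linearI)
    show "J (x + y) = J x + J y" for x y
      unfolding J_def suminf_add[OF sums sums]
      by (simp add: plus_l1.rep_eq scaleR_add_left)
    show "J (r *\<^sub>R x) = r *\<^sub>R J x" for r x
      unfolding J_def
      by (simp add: scaleR_l1.rep_eq suminf_scaleR_right[OF sums])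
  qed
  have upper_J: "norm (J a) \<le> norm a * M" for a
  proof -
    have "norm (J a) \<le> (\<Sum>n. norm (l1_nth a n *\<^sub>R v n))"
      unfolding J_def by (rule summable_norm[OF sum_norm])
    also have "\<dots> \<le> (\<Sum>n. \<bar>l1_nth a n\<bar> * M)"
      by (rule suminf_le[OF le sum_norm summable_mult2[OF summable_l1_nth]])
    also have "\<dots> = norm a * M" by (simp add: norm_l1_nth suminf_mult2[OF summable_l1_nth])
    finally show ?thesis .
  qed
  have lower_J: "\<delta> * norm a \<le> norm (J a)" for a
  proof (rule LIMSEQ_le)
    show "(\<lambda>n. \<delta> * (\<Sum>i<n. \<bar>l1_nth a i\<bar>)) \<longlonglongrightarrow> \<delta> * norm a"
      unfolding norm_l1_nth by (intro tendsto_mult_left summable_LIMSEQ summable_l1_nth)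
    show "(\<lambda>n. norm (\<Sum>i<n. l1_nth a i *\<^sub>R v i)) \<longlonglongrightarrow> norm (J a)"
      unfolding J_def by (intro tendsto_norm summable_LIMSEQ sums)
  qed (use lower in auto)
  have inj: "inj J"
    unfolding linear_injective_0[OF lin]
    using lower_J \<open>0 < \<delta>\<close> by (metis mult_le_0_iff norm_le_zero_iff norm_zero not_le)
  have bl: "bounded_linear J"
    by (rule bounded_linear_intro[where K = M])
      (use upper_J in \<open>auto simp: linear_add[OF lin] linear_scale[OF lin]\<close>)
  have "continuous_on (range J) (inv J)"
  proof (rule continuous_onI)
    fix y e assume y: "y \<in> range J" and e: "0 < (e::real)"
    show "\<exists>d>0. \<forall>x'\<in>range J. dist x' y < d \<longrightarrow> dist (inv J x') (inv J y) \<le> e"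
    proof (intro exI[of _ "\<delta> * e"] conjI ballI impI)
      fix x' assume "x' \<in> range J" "dist x' y < \<delta> * e"
      then have "\<delta> * norm (inv J x' - inv J y) \<le> \<delta> * e"
        using lower_J[of "inv J x' - inv J y"] y
        by (simp add: linear_diff[OF lin] f_inv_into_f dist_norm)
      then show "dist (inv J x') (inv J y) \<le> e" using \<open>0 < \<delta>\<close> by (simp add: dist_norm)
    qed (use e \<open>0 < \<delta>\<close> in simp)
  qed
  then have "homeomorphism UNIV (range J) J (inv J)"
    using inj linear_continuous_on[OF bl, of UNIV]
    by (auto simp: homeomorphism_def f_inv_into_f image_image)
  then show ?thesis using lin unfolding contains_isomorphic_copy_of_l1_def by blast
qed

text \<open>
  Continuity of a linear embedding and of its inverse at \<open>0\<close>, in quantitative form.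
\<close>

lemma copy_of_l1E:
  fixes V :: "'a::real_normed_vector itself"
  assumes "contains_isomorphic_copy_of_l1 V"
  obtains J :: "l1 \<Rightarrow> 'a" and \<delta> M where "linear J" "0 < \<delta>"
    "\<And>a. \<delta> * norm a \<le> norm (J a)" "\<And>a. norm (J a) \<le> M * norm a" "0 < M"
proof -
  obtain J :: "l1 \<Rightarrow> 'a" and K where lin: "linear J" and hom: "homeomorphism UNIV (range J) J K"
    using assms unfolding contains_isomorphic_copy_of_l1_def by blast
  have KJ: "K (J a) = a" for a using hom by (simp add: homeomorphism_def)
  have J0: "J 0 = 0" by (rule linear_0[OF lin])
  have "continuous_on UNIV J" "continuous_on (range J) K"
    using hom by (auto simp: homeomorphism_def)
  then obtain r s where r: "0 < r" "\<And>a. norm a < r \<Longrightarrow> norm (J a) < 1"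
    and s: "0 < s" "\<And>a. norm (J a) < s \<Longrightarrow> norm a < 1"
    unfolding continuous_on_iff
    by (metis (no_types, opaque_lifting) J0 KJ UNIV_I dist_0_norm dist_commute rangeI zero_less_one)
  have lower: "s / 2 * norm a \<le> norm (J a)" for a
  proof (rule ccontr)
    assume *: "\<not> ?thesis"
    then have a: "0 < norm a" using J0 by (cases "a = 0") auto
    have "norm (J ((1 / norm a) *\<^sub>R a)) = norm (J a) / norm a"
      using a by (simp add: linear_scale[OF lin])
    also have "\<dots> < s"
      using * a mult_pos_pos[OF s(1) a] by (simp add: divide_less_eq)
    finally have "norm ((1 / norm a) *\<^sub>R a) < 1" by (rule s(2))
    then show False using a by simp
  qed
  have upper: "norm (J a) \<le> 2 / r * norm a" for a
  proof (cases "a = 0")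
    case False
    then have a: "0 < norm a" by simp
    have "norm ((r / 2 / norm a) *\<^sub>R a) < r" using a r(1) by simp
    then have "norm (J ((r / 2 / norm a) *\<^sub>R a)) < 1" by (rule r(2))
    then have "r / 2 / norm a * norm (J a) < 1"
      using a r(1) by (simp add: linear_scale[OF lin])
    then show ?thesis using a r(1) by (simp add: field_simps)
  qed (simp add: J0)
  show thesis
    by (rule that[OF lin _ lower upper]) (use r(1) s(1) in auto)
qed

section \<open>The dual ball and its self-maps\<close>

lemma contraction_apply_le:
  assumes "norm (T :: 'a::real_normed_vector \<Rightarrow>\<^sub>L 'b::real_normed_vector) \<le> 1"
  shows "norm (blinfun_apply T x) \<le> norm x"
proof -
  have "norm (blinfun_apply T x) \<le> norm T * norm x" by (rule norm_blinfun)
  also have "\<dots> \<le> 1 * norm x" by (rule mult_right_mono[OF assms]) simp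
  finally show ?thesis by simp
qed

definition dense_sequence :: "(nat \<Rightarrow> 'a::metric_space) \<Rightarrow> bool"
  where "dense_sequence d \<longleftrightarrow> (\<forall>x e. 0 < e \<longrightarrow> (\<exists>n. dist (d n) x < e))"

lemma separable_imp_dense_sequence:
  assumes "separable_space (euclidean :: 'a::metric_space topology)"
  obtains d :: "nat \<Rightarrow> 'a::metric_space" where "dense_sequence d"
proof -
  obtain C :: "'a set" where C: "countable C" "closure C = UNIV"
    using assms by (auto simp: separable_space_def)
  then have "C \<noteq> {}" by auto
  then have "range (from_nat_into C) = C" using C(1) by (rule range_from_nat_into)
  moreover have "\<exists>y\<in>C. dist y x < e" if "0 < e" for x e
    using C(2) that by (metis UNIV_I closure_approachable)
  ultimately have "dense_sequence (from_nat_into C)"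
    unfolding dense_sequence_def by (metis (no_types, lifting) imageE)
  then show thesis by (rule that)
qed

lemma dense_sequence_blinfun_eq:
  fixes \<phi> \<psi> :: "'a::real_normed_vector \<Rightarrow>\<^sub>L real"
  assumes d: "dense_sequence d" and eq: "\<And>n. blinfun_apply \<phi> (d n) = blinfun_apply \<psi> (d n)"
  shows "\<phi> = \<psi>"
proof (rule blinfun_eqI, rule ccontr)
  fix x assume ne: "blinfun_apply \<phi> x \<noteq> blinfun_apply \<psi> x"
  define e where "e = \<bar>blinfun_apply (\<phi> - \<psi>) x\<bar>"
  have e: "0 < e" using ne by (simp add: e_def blinfun.diff_left)
  obtain n where n: "dist (d n) x < e / (norm (\<phi> - \<psi>) + 1)"
    using d e unfolding dense_sequence_def
    by (metis add_nonneg_pos divide_pos_pos norm_ge_zero zero_less_one)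
  have "e = \<bar>blinfun_apply (\<phi> - \<psi>) (x - d n)\<bar>"
    using eq[of n] by (simp add: e_def blinfun.diff_left blinfun.diff_right)
  also have "\<dots> \<le> norm (\<phi> - \<psi>) * norm (x - d n)"
    using norm_blinfun[of "\<phi> - \<psi>" "x - d n"] by simp
  also have "\<dots> \<le> (norm (\<phi> - \<psi>) + 1) * dist (d n) x"
    by (simp add: dist_norm norm_minus_commute mult_right_mono)
  also have "\<dots> < e"
    using n by (simp add: pos_less_divide_eq add_nonneg_pos mult.commute)
  finally show False by simp
qed

lemma continuous_map_dual_ball_eval: "continuous_map dual_ball euclideanreal (\<lambda>\<phi>. blinfun_apply \<phi> v)"
proof -
  have "continuous_map weak_star_topology euclideanreal ((\<lambda>f. f v) \<circ> blinfun_apply)"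
    unfolding weak_star_topology_def
    by (intro continuous_map_pullback continuous_map_product_projection) simp
  then show ?thesis
    unfolding dual_ball_def by (auto intro: continuous_map_from_subtopology simp: o_def)
qed

lemma continuous_map_into_dual_ball:
  assumes "\<And>v. continuous_map T euclideanreal (\<lambda>x. blinfun_apply (f x) v)"
    "f \<in> topspace T \<rightarrow> cball 0 1"
  shows "continuous_map T dual_ball f"
proof -
  have "continuous_map T weak_star_topology f"
    unfolding weak_star_topology_def
    by (rule continuous_map_pullback')
      (use assms(1) in \<open>auto simp: continuous_map_componentwise_UNIV\<close>)
  then show ?thesis
    using assms(2) by (simp add: dual_ball_def continuous_map_in_subtopology image_subset_iff_funcset)
qed

lemma limitin_dual_ball:
  assumes "\<And>v. (\<lambda>n. blinfun_apply (f n) v) \<longlonglongrightarrow> blinfun_apply l v"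
    "\<And>n. f n \<in> cball 0 1" "l \<in> cball 0 1"
  shows "limitin dual_ball f l sequentially"
proof -
  have lim: "limitin (product_topology (\<lambda>_. euclideanreal) UNIV) (\<lambda>n. blinfun_apply (f n)) (blinfun_apply l) sequentially"
    using assms(1) by (simp add: limitin_componentwise)
  have "limitin weak_star_topology f l sequentially"
    unfolding limitin_def
  proof (intro conjI allI impI)
    show "l \<in> topspace weak_star_topology"
      by (simp add: weak_star_topology_def topspace_pullback_topology)
    fix U assume "openin weak_star_topology U \<and> l \<in> U"
    then obtain U' where "openin (product_topology (\<lambda>_. euclideanreal) UNIV) U'" "U = blinfun_apply -` U'"
      "blinfun_apply l \<in> U'"
      unfolding weak_star_topology_def openin_pullback_topology by auto
    then show "\<forall>\<^sub>F n in sequentially. f n \<in> U"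
      using limitinD[OF lim] by simp
  qed
  then show ?thesis
    unfolding dual_ball_def limitin_subtopology using assms(2,3) by simp
qed

lemma Hausdorff_space_dual_ball: "Hausdorff_space dual_ball"
  unfolding Hausdorff_space_def
proof (intro allI impI, elim conjE)
  fix \<phi> \<psi> :: "'a \<Rightarrow>\<^sub>L real"
  assume top: "\<phi> \<in> topspace dual_ball" "\<psi> \<in> topspace dual_ball" and "\<phi> \<noteq> \<psi>"
  then obtain v where v: "blinfun_apply \<phi> v \<noteq> blinfun_apply \<psi> v" using blinfun_eqI by blast
  then obtain U V where UV: "open U" "open V" "blinfun_apply \<phi> v \<in> U" "blinfun_apply \<psi> v \<in> V" "U \<inter> V = {}"
    using hausdorff by metis
  have *: "openin dual_ball {\<phi> \<in> topspace dual_ball. blinfun_apply \<phi> v \<in> W}" if "open W" for W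
    by (rule openin_continuous_map_preimage[OF continuous_map_dual_ball_eval]) (use that in simp)
  show "\<exists>U V. openin dual_ball U \<and> openin dual_ball V \<and> \<phi> \<in> U \<and> \<psi> \<in> V \<and> disjnt U V"
    using *[OF UV(1)] *[OF UV(2)] UV top
    by (intro exI[of _ "{\<phi> \<in> topspace dual_ball. blinfun_apply \<phi> v \<in> U}"]
        exI[of _ "{\<phi> \<in> topspace dual_ball. blinfun_apply \<phi> v \<in> V}"]) (auto simp: disjnt_def)
qed

text \<open>
  The Banach-Alaoglu theorem.
\<close>

lemma compact_space_dual_ball: "compact_space (dual_ball :: ('a::real_normed_vector \<Rightarrow>\<^sub>L real) topology)"
proof -
  \<comment> \<open>The functionals in the ball, as a closed subset of a product of compact intervals.\<close>
  define L :: "('a \<Rightarrow> real) set" where "L = {f. (\<forall>x y. f (x + y) = f x + f y) \<and>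
    (\<forall>r x. f (r *\<^sub>R x) = r * f x) \<and> (\<forall>x. \<bar>f x\<bar> \<le> norm x)}"
  let ?P = "product_topology (\<lambda>_::'a. euclideanreal) UNIV"
  have "closed L"
  proof -
    have L: "L = (\<Inter>x. \<Inter>y. {f. f (x + y) = f x + f y}) \<inter> (\<Inter>r. \<Inter>x. {f. f (r *\<^sub>R x) = r * f x}) \<inter>
        (\<Inter>x. {f. \<bar>f x\<bar> \<le> norm x})"
      by (auto simp: L_def)
    show ?thesis
      unfolding L
      by (intro closed_Int closed_INT ballI closed_Collect_eq closed_Collect_le
          continuous_on_product_coordinates continuous_intros)
  qed
  then have "closedin ?P L" by (simp add: euclidean_product_topology)
  moreover have "compactin ?P (PiE UNIV (\<lambda>x. {- norm x..norm x}))"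
    by (simp add: compactin_PiE)
  moreover have "L \<subseteq> PiE UNIV (\<lambda>x. {- norm x..norm x})"
    by (auto simp: L_def abs_le_iff) (metis minus_le_iff)
  ultimately have L: "compactin ?P L" using closed_compactin by blast
  have bl: "bounded_linear f" if "f \<in> L" for f
    by (rule bounded_linear_intro[where K = 1]) (use that in \<open>auto simp: L_def\<close>)
  have "continuous_map (subtopology ?P L) dual_ball Blinfun"
  proof (rule continuous_map_into_dual_ball)
    fix v
    have "continuous_map (subtopology ?P L) euclideanreal (\<lambda>f. f v)"
      by (intro continuous_map_from_subtopology continuous_map_product_projection) simp
    then show "continuous_map (subtopology ?P L) euclideanreal (\<lambda>f. blinfun_apply (Blinfun f) v)"
      by (rule continuous_map_eq) (simp add: bounded_linear_Blinfun_apply[OF bl])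
  next
    have "norm (Blinfun f) \<le> 1" if "f \<in> L" for f
      by (rule norm_blinfun_bound)
        (use that in \<open>auto simp: bounded_linear_Blinfun_apply[OF bl] L_def\<close>)
    then show "Blinfun \<in> topspace (subtopology ?P L) \<rightarrow> cball 0 1" by auto
  qed
  moreover have "compactin (subtopology ?P L) L" using L by (simp add: compactin_subtopology)
  ultimately have "compactin dual_ball (Blinfun ` L)" by (rule image_compactin[rotated])
  moreover have "cball 0 1 \<subseteq> Blinfun ` L"
  proof
    fix \<phi> :: "'a \<Rightarrow>\<^sub>L real" assume \<phi>: "\<phi> \<in> cball 0 1"
    have "\<bar>blinfun_apply \<phi> x\<bar> \<le> norm x" for x
      using contraction_apply_le[of \<phi> x] \<phi> by simp
    then have "blinfun_apply \<phi> \<in> L"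
      by (auto simp: L_def blinfun.add_right blinfun.scaleR_right)
    then show "\<phi> \<in> Blinfun ` L" by (metis blinfun_apply_inverse imageI)
  qed
  moreover have "Blinfun ` L \<subseteq> topspace dual_ball"
    using \<open>compactin dual_ball (Blinfun ` L)\<close> by (rule compactin_subset_topspace)
  ultimately show ?thesis
    unfolding compact_space_def topspace_dual_ball by (metis subset_antisym topspace_dual_ball)
qed

text \<open>
  Evaluation at a dense sequence is injective on functionals, so compactness makes it an
  embedding of the dual ball into a countable power of the real line.
\<close>

lemma dual_ball_metrizable_second_countable:
  assumes d: "dense_sequence (d :: nat \<Rightarrow> 'a::real_normed_vector)"
  shows "metrizable_space (dual_ball :: ('a \<Rightarrow>\<^sub>L real) topology)"
    and "second_countable (dual_ball :: ('a \<Rightarrow>\<^sub>L real) topology)"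
proof -
  let ?D = "dual_ball :: ('a \<Rightarrow>\<^sub>L real) topology"
  let ?N = "product_topology (\<lambda>_::nat. euclideanreal) UNIV"
  let ?c = "\<lambda>(\<phi> :: 'a \<Rightarrow>\<^sub>L real) n. blinfun_apply \<phi> (d n)"
  have "embedding_map ?D ?N ?c"
  proof (rule continuous_imp_embedding_map)
    show "continuous_map ?D ?N ?c"
      by (simp add: continuous_map_componentwise_UNIV continuous_map_dual_ball_eval)
    show "inj_on ?c (topspace ?D)"
      by (rule inj_onI) (metis dense_sequence_blinfun_eq[OF d])
  qed (simp_all add: compact_space_dual_ball Hausdorff_space_product_topology)
  then have hom: "?D homeomorphic_space subtopology ?N (?c ` topspace ?D)"
    by (rule embedding_map_imp_homeomorphic_space)
  have N: "?N = euclidean" by (rule euclidean_product_topology)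
  have "metrizable_space ?N" unfolding N by (rule metrizable_space_euclidean)
  then show "metrizable_space ?D"
    using hom homeomorphic_metrizable_space metrizable_space_subtopology by blast
  have "second_countable (euclidean :: (nat \<Rightarrow> real) topology)"
  proof -
    obtain B :: "(nat \<Rightarrow> real) set set" where B: "countable B" "topological_basis B"
      using ex_countable_basis by blast
    have "\<exists>V\<in>B. x \<in> V \<and> V \<subseteq> U" if "open U" "x \<in> U" for U x
      by (rule topological_basisE[OF B(2) that]) blast
    then show ?thesis
      unfolding second_countable_def using B topological_basis_open[OF B(2)]
      by (intro exI[of _ B]) simp
  qed
  then have "second_countable ?N" unfolding N .
  then show "second_countable ?D"
    using hom homeomorphic_space_second_countability second_countable_subtopology by blast
qed

lemma topspace_dual_ball_self_maps:
  "topspace dual_ball_self_maps = cball 0 1 \<rightarrow>\<^sub>E cball 0 1"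
  by (simp add: dual_ball_self_maps_def topspace_dual_ball)

lemma compact_space_dual_ball_self_maps: "compact_space dual_ball_self_maps"
  by (simp add: dual_ball_self_maps_def compact_space_product_topology compact_space_dual_ball)

lemma Hausdorff_space_dual_ball_self_maps: "Hausdorff_space dual_ball_self_maps"
  by (simp add: dual_ball_self_maps_def Hausdorff_space_product_topology Hausdorff_space_dual_ball)

lemma continuous_map_self_maps_eval:
  assumes "\<phi> \<in> cball 0 1"
  shows "continuous_map dual_ball_self_maps euclideanreal (\<lambda>p. blinfun_apply (p \<phi>) v)"
proof -
  have "continuous_map dual_ball_self_maps dual_ball (\<lambda>p. p \<phi>)"
    unfolding dual_ball_self_maps_def
    by (rule continuous_map_product_projection) (use assms in \<open>simp add: topspace_dual_ball\<close>)
  then show ?thesis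
    using continuous_map_compose[OF _ continuous_map_dual_ball_eval] by (fastforce simp: o_def)
qed

lemma embedding_self_maps_coords:
  assumes d: "dense_sequence (d :: nat \<Rightarrow> 'a::real_normed_vector)"
  shows "embedding_map (dual_ball_self_maps :: (('a \<Rightarrow>\<^sub>L real) \<Rightarrow> ('a \<Rightarrow>\<^sub>L real)) topology)
    (product_topology (\<lambda>_. euclideanreal) (cball 0 1 \<times> UNIV))
    (\<lambda>p. \<lambda>(\<phi>, n)\<in>cball 0 1 \<times> UNIV. blinfun_apply (p \<phi>) (d n))"
proof (rule continuous_imp_embedding_map)
  let ?c = "\<lambda>p. \<lambda>(\<phi>, n)\<in>cball 0 1 \<times> UNIV. blinfun_apply (p \<phi>) (d n)"
  show "continuous_map dual_ball_self_maps (product_topology (\<lambda>_. euclideanreal) (cball 0 1 \<times> UNIV)) ?c"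
    unfolding continuous_map_componentwise
    by (auto intro: continuous_map_self_maps_eval)
  show "inj_on ?c (topspace dual_ball_self_maps)"
  proof (rule inj_onI)
    fix p q assume p: "p \<in> topspace dual_ball_self_maps" and q: "q \<in> topspace dual_ball_self_maps"
      and eq: "?c p = ?c q"
    have "p \<phi> = q \<phi>" if "\<phi> \<in> cball 0 1" for \<phi>
    proof (rule dense_sequence_blinfun_eq[OF d])
      fix n show "blinfun_apply (p \<phi>) (d n) = blinfun_apply (q \<phi>) (d n)"
        using fun_cong[OF eq, of "(\<phi>, n)"] that by simp
    qed
    then show "p = q" using p q unfolding topspace_dual_ball_self_maps by (metis PiE_ext)
  qed
qed (simp_all add: compact_space_dual_ball_self_maps Hausdorff_space_product_topology)

section \<open>The enveloping semigroup\<close>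

abbreviation adjoint_maps :: "(('a::real_normed_vector \<Rightarrow>\<^sub>L real) \<Rightarrow> ('a \<Rightarrow>\<^sub>L real)) set"
  where "adjoint_maps \<equiv> {restrict (adjoint_op T) (topspace dual_ball) | T :: 'a \<Rightarrow>\<^sub>L 'a. norm T \<le> 1}"

lemma adjoint_maps_subset: "adjoint_maps \<subseteq> topspace dual_ball_self_maps"
  using restrict_adjoint_op_in_dual_ball_self_maps by blast

lemma topspace_enveloping_semigroup:
  "topspace (enveloping_semigroup V) = dual_ball_self_maps closure_of adjoint_maps"
  unfolding enveloping_semigroup_def
  by (simp add: inf_absorb2[OF closure_of_subset_topspace])

lemma compact_space_enveloping_semigroup: "compact_space (enveloping_semigroup V)"
  unfolding enveloping_semigroup_def
  by (rule compact_space_subtopology, rule closedin_compact_space[OF compact_space_dual_ball_self_maps])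
    (rule closedin_closure_of)

text \<open>
  Elements of the enveloping semigroup are pointwise limits of adjoints: for fixed
  \<open>v\<close>, the function \<open>\<phi> \<mapsto> p \<phi> v\<close> lies in the
  pointwise closure of the evaluations at the vectors \<open>T v\<close>.
\<close>

lemma enveloping_semigroup_approx:
  fixes V :: "'a::banach itself"
  assumes p: "p \<in> topspace (enveloping_semigroup V)"
    and P: "finite P" "P \<subseteq> cball 0 1" and e: "0 < e"
  obtains T :: "'a \<Rightarrow>\<^sub>L 'a" where "norm T \<le> 1"
    "\<And>\<phi>. \<phi> \<in> P \<Longrightarrow> \<bar>blinfun_apply \<phi> (blinfun_apply T v) - blinfun_apply (p \<phi>) v\<bar> < e"
proof -
  have p': "p \<in> dual_ball_self_maps closure_of adjoint_maps"
    using p unfolding topspace_enveloping_semigroup .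
  then have ptop: "p \<in> topspace dual_ball_self_maps" by (rule in_closure_of[THEN iffD1, THEN conjunct1])
  define W where "W = topspace dual_ball_self_maps \<inter>
    (\<Inter>\<phi>\<in>P. {q \<in> topspace dual_ball_self_maps. blinfun_apply (q \<phi>) v \<in> ball (blinfun_apply (p \<phi>) v) e})"
  have "openin dual_ball_self_maps W"
    unfolding W_def
  proof (rule openin_Int_Inter)
    fix Y
    assume "Y \<in> (\<lambda>\<phi>. {q \<in> topspace dual_ball_self_maps.
        blinfun_apply (q \<phi>) v \<in> ball (blinfun_apply (p \<phi>) v) e}) ` P"
    then obtain \<phi> where "\<phi> \<in> P" and Y: "Y = {q \<in> topspace dual_ball_self_maps.
        blinfun_apply (q \<phi>) v \<in> ball (blinfun_apply (p \<phi>) v) e}"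
      by blast
    then show "openin dual_ball_self_maps Y"
      unfolding Y using P(2) by (intro openin_continuous_map_preimage[OF continuous_map_self_maps_eval]) auto
  qed (use P(1) in auto)
  moreover have "p \<in> W" using ptop e by (auto simp: W_def)
  ultimately obtain q where q: "q \<in> adjoint_maps" "q \<in> W"
    using p' unfolding in_closure_of by blast
  then obtain T :: "'a \<Rightarrow>\<^sub>L 'a" where T: "norm T \<le> 1" "q = restrict (adjoint_op T) (topspace dual_ball)"
    by blast
  show thesis
  proof (rule that[OF T(1)])
    fix \<phi> assume "\<phi> \<in> P"
    then have "blinfun_apply (q \<phi>) v \<in> ball (blinfun_apply (p \<phi>) v) e" "\<phi> \<in> cball 0 1"
      using q(2) P(2) by (auto simp: W_def)
    then show "\<bar>blinfun_apply \<phi> (blinfun_apply T v) - blinfun_apply (p \<phi>) v\<bar> < e"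
      by (simp add: T(2) topspace_dual_ball adjoint_op_def dist_real_def abs_minus_commute)
  qed
qed

lemma limitin_in_closure_of:
  assumes "limitin X f l sequentially" "\<And>n. f n \<in> Q"
  shows "l \<in> X closure_of Q"
  unfolding in_closure_of
proof (intro conjI allI impI)
  show "l \<in> topspace X" using assms(1) by (rule limitin_topspace)
  fix U assume "l \<in> U \<and> openin X U"
  then have "\<forall>\<^sub>F n in sequentially. f n \<in> U" using limitinD[OF assms(1)] by blast
  then obtain n where "f n \<in> U" by (auto simp: eventually_sequentially)
  then show "\<exists>y. y \<in> Q \<and> y \<in> U" using assms(2) by blast
qed

text \<open>
  Separability of the unit ball of operators for the strong operator topology, in the sequential
  form from which pointwise weak-star convergence of the adjoints is read off.
\<close>

lemma contractions_strongly_separable: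
  assumes d: "dense_sequence (d :: nat \<Rightarrow> 'a::real_normed_vector)"
  obtains Q :: "('a::real_normed_vector \<Rightarrow>\<^sub>L 'a) set" where "countable Q" "\<And>T. T \<in> Q \<Longrightarrow> norm T \<le> 1"
    "\<And>S. norm S \<le> 1 \<Longrightarrow> \<exists>R. (\<forall>N::nat. R N \<in> Q) \<and>
      (\<forall>x. (\<lambda>N. blinfun_apply (R N) x) \<longlonglongrightarrow> blinfun_apply S x)"
proof -
  define near where "near ms T \<longleftrightarrow> norm T \<le> 1 \<and>
    (\<forall>i<length ms. dist (blinfun_apply T (d i)) (d (ms ! i)) < 1 / real (Suc (length ms)))"
    for ms :: "nat list" and T :: "'a \<Rightarrow>\<^sub>L 'a"
  \<comment> \<open>One contraction for each finite list of targets: \<open>ms\<close> prescribes, up to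
    \<open>1 / (length ms + 1)\<close>, which dense points the first \<open>d i\<close> are sent to.\<close>
  define choice where "choice ms = (SOME T. near ms T)" for ms
  define Q where "Q = choice ` {ms. \<exists>T. near ms T}"
  have near_choice: "near ms (choice ms)" if "near ms T" for ms T
    unfolding choice_def using that by (rule someI)
  have Q1: "norm T \<le> 1" if "T \<in> Q" for T
    using that near_choice unfolding Q_def near_def by blast
  show thesis
  proof (rule that[of Q])
    show "countable Q" by (simp add: Q_def)
    show "norm T \<le> 1" if "T \<in> Q" for T by (rule Q1[OF that])
    fix S :: "'a \<Rightarrow>\<^sub>L 'a" assume S: "norm S \<le> 1"
    have "\<exists>T\<in>Q. \<forall>i<N. dist (blinfun_apply T (d i)) (blinfun_apply S (d i)) < 2 / real (Suc N)" for N
    proof -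
      have "\<exists>m. dist (blinfun_apply S (d i)) (d m) < 1 / real (Suc N)" for i
        using d unfolding dense_sequence_def by (metis dist_commute of_nat_0_less_iff zero_less_Suc zero_less_divide_1_iff)
      then obtain m where m: "\<And>i. dist (blinfun_apply S (d i)) (d (m i)) < 1 / real (Suc N)"
        by metis
      define ms where "ms = map m [0..<N]"
      have "near ms S" using S m by (simp add: near_def ms_def)
      then have "near ms (choice ms)" and Q: "choice ms \<in> Q" using near_choice by (auto simp: Q_def)
      then have *: "dist (blinfun_apply (choice ms) (d i)) (d (m i)) < 1 / real (Suc N)" if "i < N" for i
        using that by (simp add: near_def ms_def)
      have "dist (blinfun_apply (choice ms) (d i)) (blinfun_apply S (d i)) < 2 / real (Suc N)" if "i < N" for i
      proof -
        have "dist (blinfun_apply (choice ms) (d i)) (blinfun_apply S (d i)) < 1 / real (Suc N) + 1 / real (Suc N)"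
          using *[OF that] m[of i]
            dist_triangle2[of "blinfun_apply (choice ms) (d i)" "blinfun_apply S (d i)" "d (m i)"] by linarith
        then show ?thesis by simp
      qed
      with Q show ?thesis by blast
    qed
    then obtain R where RQ: "\<And>N. R N \<in> Q"
      and R: "\<And>N i. i < N \<Longrightarrow> dist (blinfun_apply (R N) (d i)) (blinfun_apply S (d i)) < 2 / real (Suc N)"
      by metis
    have R1: "norm (R N) \<le> 1" for N by (rule Q1[OF RQ])
    have "(\<lambda>N. blinfun_apply (R N) x) \<longlonglongrightarrow> blinfun_apply S x" for x
    proof (rule metric_LIMSEQ_I)
      fix e :: real assume e: "0 < e"
      obtain i where i: "dist (d i) x < e / 4"
        using d e unfolding dense_sequence_def by (meson divide_pos_pos zero_less_numeral)
      obtain K :: nat where K: "4 / e < real K" using reals_Archimedean2 by blast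
      show "\<exists>N0. \<forall>N\<ge>N0. dist (blinfun_apply (R N) x) (blinfun_apply S x) < e"
      proof (intro exI[of _ "max K (Suc i)"] allI impI)
        fix N assume N: "max K (Suc i) \<le> N"
        have "4 / e < real (Suc N)" using K N by simp
        then have small: "2 / real (Suc N) < e / 2" using e by (simp add: field_simps)
        have "dist (blinfun_apply (R N) x) (blinfun_apply (R N) (d i)) \<le> dist (d i) x"
          using contraction_apply_le[OF R1, of N "x - d i"]
          by (simp add: dist_norm blinfun.diff_right norm_minus_commute)
        moreover have "dist (blinfun_apply S (d i)) (blinfun_apply S x) \<le> dist (d i) x"
          using contraction_apply_le[OF S, of "d i - x"] by (simp add: dist_norm blinfun.diff_right)
        moreover have "dist (blinfun_apply (R N) (d i)) (blinfun_apply S (d i)) < 2 / real (Suc N)"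
          using R N by simp
        ultimately show "dist (blinfun_apply (R N) x) (blinfun_apply S x) < e"
          using i small
            dist_triangle[of "blinfun_apply (R N) x" "blinfun_apply S x" "blinfun_apply (R N) (d i)"]
            dist_triangle[of "blinfun_apply (R N) (d i)" "blinfun_apply S x" "blinfun_apply S (d i)"]
          by linarith
      qed
    qed
    then show "\<exists>R. (\<forall>N::nat. R N \<in> Q) \<and> (\<forall>x. (\<lambda>N. blinfun_apply (R N) x) \<longlonglongrightarrow> blinfun_apply S x)"
      using RQ by blast
  qed
qed

lemma separable_space_enveloping_semigroup:
  fixes V :: "'a::banach itself"
  assumes d: "dense_sequence (d :: nat \<Rightarrow> 'a)"
  shows "separable_space (enveloping_semigroup V)"
proof -
  obtain Q :: "('a \<Rightarrow>\<^sub>L 'a) set" where Q: "countable Q" "\<And>T. T \<in> Q \<Longrightarrow> norm T \<le> 1"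
    "\<And>S. norm S \<le> 1 \<Longrightarrow> \<exists>R. (\<forall>N::nat. R N \<in> Q) \<and>
      (\<forall>x. (\<lambda>N. blinfun_apply (R N) x) \<longlonglongrightarrow> blinfun_apply S x)"
    using contractions_strongly_separable[OF d] by metis
  let ?Y = "dual_ball_self_maps :: (('a \<Rightarrow>\<^sub>L real) \<Rightarrow> ('a \<Rightarrow>\<^sub>L real)) topology"
  let ?r = "\<lambda>T :: 'a \<Rightarrow>\<^sub>L 'a. restrict (adjoint_op T) (topspace dual_ball)"
  have in_Y: "?r T \<in> topspace ?Y" if "norm T \<le> 1" for T
    using that by (rule restrict_adjoint_op_in_dual_ball_self_maps)
  have "?r S \<in> ?Y closure_of (?r ` Q)" if S: "norm S \<le> 1" for S
  proof -
    obtain R where R: "\<And>N::nat. R N \<in> Q" "\<And>x. (\<lambda>N. blinfun_apply (R N) x) \<longlonglongrightarrow> blinfun_apply S x"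
      using Q(3)[OF S] by blast
    have R1: "norm (R N) \<le> 1" for N using Q(2) R(1) by blast
    have ball: "adjoint_op T \<phi> \<in> cball 0 1" if "norm T \<le> 1" "\<phi> \<in> topspace dual_ball" for T :: "'a \<Rightarrow>\<^sub>L 'a" and \<phi>
      using in_Y[OF that(1)] that(2) by (auto simp: topspace_dual_ball_self_maps topspace_dual_ball PiE_iff)
    have "limitin ?Y (\<lambda>N. ?r (R N)) (?r S) sequentially"
      unfolding dual_ball_self_maps_def limitin_componentwise
    proof (intro conjI ballI)
      show "\<forall>\<^sub>F N in sequentially. ?r (R N) \<in> topspace (product_topology (\<lambda>_. dual_ball) (topspace dual_ball))"
        using in_Y[OF R1] unfolding dual_ball_self_maps_def by (intro always_eventually allI)
      fix \<phi> :: "'a \<Rightarrow>\<^sub>L real" assume \<phi>: "\<phi> \<in> topspace dual_ball"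
      have "limitin dual_ball (\<lambda>N. adjoint_op (R N) \<phi>) (adjoint_op S \<phi>) sequentially"
      proof (rule limitin_dual_ball)
        show "(\<lambda>N. blinfun_apply (adjoint_op (R N) \<phi>) v) \<longlonglongrightarrow> blinfun_apply (adjoint_op S \<phi>) v" for v
          unfolding adjoint_op_def blinfun_apply_blinfun_compose
          by (intro blinfun.tendsto tendsto_const R(2))
      qed (use ball R1 S \<phi> in auto)
      then show "limitin dual_ball (\<lambda>N. ?r (R N) \<phi>) (?r S \<phi>) sequentially"
        using \<phi> by simp
    qed simp
    then show ?thesis by (rule limitin_in_closure_of) (use R(1) in blast)
  qed
  then have "adjoint_maps \<subseteq> ?Y closure_of (?r ` Q)" by blast
  then have "?Y closure_of adjoint_maps \<subseteq> ?Y closure_of (?r ` Q)"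
    by (rule closure_of_minimal) simp
  moreover have QA: "?r ` Q \<subseteq> adjoint_maps" using Q(2) by blast
  moreover have AC: "adjoint_maps \<subseteq> ?Y closure_of adjoint_maps"
    by (rule closure_of_subset[OF adjoint_maps_subset])
  ultimately have "enveloping_semigroup V closure_of (?r ` Q) = topspace (enveloping_semigroup V)"
    unfolding topspace_enveloping_semigroup
    unfolding enveloping_semigroup_def closure_of_subtopology
    by (metis (no_types, lifting) inf.absorb_iff1 inf.absorb_iff2 order_trans)
  moreover have "?r ` Q \<subseteq> topspace (enveloping_semigroup V)"
    unfolding topspace_enveloping_semigroup using QA AC by blast
  ultimately show ?thesis
    unfolding separable_space_def using Q(1) by blast
qed

section \<open>Spaces without \<open>l\<^sub>1\<close>\<close>

text \<open>
  If a coordinate of \<open>p\<close> were not of the first Baire class, it would oscillate on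
  some closed subset of the dual ball. Being a pointwise limit of evaluations at vectors
  \<open>T v\<close> of bounded norm, it would then produce an independent sequence of such
  vectors, which spans a copy of \<open>l\<^sub>1\<close>.
\<close>

lemma no_l1_imp_limit_of_continuous:
  fixes V :: "'a::banach itself" and d :: "nat \<Rightarrow> 'a"
  assumes d: "dense_sequence d" and no: "\<not> contains_isomorphic_copy_of_l1 V"
    and p: "p \<in> topspace (enveloping_semigroup V)"
  shows "limit_of_continuous dual_ball (\<lambda>\<phi>. blinfun_apply (p \<phi>) v)"
proof (rule no_oscillation_imp_limit_of_continuous)
  show "metrizable_space (dual_ball :: ('a \<Rightarrow>\<^sub>L real) topology)"
    "second_countable (dual_ball :: ('a \<Rightarrow>\<^sub>L real) topology)"
    using dual_ball_metrizable_second_countable[OF d] .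
next
  fix \<phi> :: "'a \<Rightarrow>\<^sub>L real" assume "\<phi> \<in> topspace dual_ball"
  moreover have "p \<in> topspace dual_ball_self_maps"
    using p unfolding topspace_enveloping_semigroup by (rule in_closure_of[THEN iffD1, THEN conjunct1])
  ultimately have "norm (p \<phi>) \<le> 1"
    by (auto simp: topspace_dual_ball_self_maps topspace_dual_ball PiE_iff)
  then show "\<bar>blinfun_apply (p \<phi>) v\<bar> \<le> norm v"
    using contraction_apply_le[of "p \<phi>" v] by simp
next
  fix F :: "('a \<Rightarrow>\<^sub>L real) set" and a b assume ab: "a < (b::real)" and F: "closedin dual_ball F" "F \<noteq> {}"
  show "\<exists>W. openin dual_ball W \<and> W \<inter> F \<noteq> {} \<and>
    (W \<inter> F \<inter> {\<phi>. blinfun_apply (p \<phi>) v \<le> a} = {} \<or> W \<inter> F \<inter> {\<phi>. b \<le> blinfun_apply (p \<phi>) v} = {})"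
  proof (rule ccontr)
    assume *: "\<not> ?thesis"
    have FB: "F \<subseteq> topspace dual_ball" using F(1) by (rule closedin_subset)
    define S :: "(('a \<Rightarrow>\<^sub>L real) \<Rightarrow> real) set"
      where "S = {\<lambda>\<phi>. blinfun_apply \<phi> (blinfun_apply T v) | T :: 'a \<Rightarrow>\<^sub>L 'a. norm T \<le> 1}"
    define a' where "a' = (2 * a + b) / 3"
    define b' where "b' = (a + 2 * b) / 3"
    have ab': "a < a'" "a' < b'" "b' < b" using ab by (auto simp: a'_def b'_def)
    obtain h :: "nat \<Rightarrow> ('a \<Rightarrow>\<^sub>L real) \<Rightarrow> real" where h: "\<And>n. h n \<in> S"
      "\<And>n I. \<exists>\<phi>\<in>F. \<forall>i<n. if i \<in> I then b' < h i \<phi> else h i \<phi> < a'"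
    proof (rule oscillation_imp_independent_sequence[of S dual_ball "\<lambda>\<phi>. blinfun_apply (p \<phi>) v" F a b a' b'])
      show "continuous_map dual_ball euclideanreal h" if "h \<in> S" for h
        using that continuous_map_dual_ball_eval by (auto simp: S_def)
      show "\<exists>h\<in>S. \<forall>\<phi>\<in>P. \<bar>h \<phi> - blinfun_apply (p \<phi>) v\<bar> < e"
        if P: "finite P" "P \<subseteq> topspace dual_ball" and e: "0 < e" for P e
      proof -
        obtain T :: "'a \<Rightarrow>\<^sub>L 'a" where "norm T \<le> 1"
          "\<And>\<phi>. \<phi> \<in> P \<Longrightarrow> \<bar>blinfun_apply \<phi> (blinfun_apply T v) - blinfun_apply (p \<phi>) v\<bar> < e"
          using enveloping_semigroup_approx[OF p P(1) _ e, of v] P(2)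
          unfolding topspace_dual_ball by blast
        then show ?thesis
          by (intro bexI[of _ "\<lambda>\<phi>. blinfun_apply \<phi> (blinfun_apply T v)"]) (auto simp: S_def)
      qed
      show "(\<exists>\<phi>\<in>W \<inter> F. blinfun_apply (p \<phi>) v \<le> a) \<and> (\<exists>\<phi>\<in>W \<inter> F. b \<le> blinfun_apply (p \<phi>) v)"
        if "openin dual_ball W" "W \<inter> F \<noteq> {}" for W
        using * that by blast
    qed (use FB F(2) ab' in auto)
    have "\<exists>w. h n = (\<lambda>\<phi>. blinfun_apply \<phi> w) \<and> norm w \<le> norm v" for n
    proof -
      obtain T :: "'a \<Rightarrow>\<^sub>L 'a" where T: "norm T \<le> 1" "h n = (\<lambda>\<phi>. blinfun_apply \<phi> (blinfun_apply T v))"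
        using h(1)[of n] unfolding S_def by blast
      then show ?thesis using contraction_apply_le[OF T(1), of v] by blast
    qed
    then obtain w where w: "\<And>n. h n = (\<lambda>\<phi>. blinfun_apply \<phi> (w n))" "\<And>n. norm (w n) \<le> norm v"
      by metis
    have indep: "\<exists>\<phi>\<in>F. \<forall>i<n. if i \<in> I then b' < blinfun_apply \<phi> (w i) else blinfun_apply \<phi> (w i) < a'"
      for n I using h(2)[of n I] unfolding w(1) .
    have "contains_isomorphic_copy_of_l1 V"
    proof (rule l1_basis_imp_copy)
      show "norm (w n) \<le> norm v" for n by (rule w(2))
      show "0 < (b' - a') / 2" using ab' by simp
      show "(b' - a') / 2 * (\<Sum>i<n. \<bar>c i\<bar>) \<le> norm (\<Sum>i<n. c i *\<^sub>R w i)" for n c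
        by (rule independent_lower_bound[of F, OF _ indep])
          (use FB ab' in \<open>auto simp: topspace_dual_ball\<close>)
    qed
    with no show False by simp
  qed
qed

text \<open>
  The Polish space is the product of the dual ball with a discrete sequence of indices: a point
  \<open>p\<close> becomes the function \<open>(\<phi>, n) \<mapsto> p \<phi> (d n)\<close>,
  whose slices are of the first Baire class.
\<close>

lemma no_l1_imp_Rosenthal_compactum:
  fixes V :: "'a::banach itself" and d :: "nat \<Rightarrow> 'a"
  assumes d: "dense_sequence d" and no: "\<not> contains_isomorphic_copy_of_l1 V"
  shows "Rosenthal_compactum (enveloping_semigroup V)"
proof -
  define X :: "(('a \<Rightarrow>\<^sub>L real) \<times> nat) topology" where "X = prod_topology dual_ball (discrete_topology UNIV)"
  have topX: "topspace X = cball 0 1 \<times> UNIV" by (simp add: X_def topspace_dual_ball)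
  define c where "c p = (\<lambda>(\<phi>, n)\<in>cball 0 1 \<times> UNIV. blinfun_apply (p \<phi>) (d n))"
    for p :: "('a \<Rightarrow>\<^sub>L real) \<Rightarrow> ('a \<Rightarrow>\<^sub>L real)"
  let ?E = "enveloping_semigroup V"
  have emb: "embedding_map dual_ball_self_maps (pointwise_topology X) c"
    using embedding_self_maps_coords[OF d] unfolding pointwise_topology_def topX c_def .
  define C where "C = dual_ball_self_maps closure_of (adjoint_maps :: (('a \<Rightarrow>\<^sub>L real) \<Rightarrow> _) set)"
  have E: "?E = subtopology dual_ball_self_maps C"
    by (simp add: enveloping_semigroup_def C_def)
  have topE: "topspace ?E = C" unfolding topspace_enveloping_semigroup C_def ..
  have "embedding_map ?E (pointwise_topology X) c"
  proof (rule continuous_imp_embedding_map)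
    show "continuous_map ?E (pointwise_topology X) c"
      unfolding E using emb
      by (intro continuous_map_from_subtopology)
        (metis embedding_map_def homeomorphic_imp_continuous_map continuous_map_in_subtopology)
    show "inj_on c (topspace ?E)"
      using emb closure_of_subset_topspace[of dual_ball_self_maps] unfolding topE C_def embedding_map_def
      by (meson homeomorphic_imp_injective_map inj_on_subset)
  qed (simp_all add: compact_space_enveloping_semigroup pointwise_topology_def Hausdorff_space_product_topology)
  then have hom: "?E homeomorphic_space subtopology (pointwise_topology X) (c ` topspace ?E)"
    and cont: "continuous_map ?E (pointwise_topology X) c"
    by (auto simp: embedding_map_imp_homeomorphic_space embedding_map_def
        dest!: homeomorphic_imp_continuous_map continuous_map_into_fulltopology)
  show ?thesis
  proof (rule Rosenthal_compactumI[OF _ _ _ hom])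
    have "locally_compact_space (dual_ball :: ('a \<Rightarrow>\<^sub>L real) topology)"
      by (simp add: compact_imp_locally_compact_space compact_space_dual_ball)
    then have "completely_metrizable_space (dual_ball :: ('a \<Rightarrow>\<^sub>L real) topology)"
      using dual_ball_metrizable_second_countable(1)[OF d] locally_compact_imp_completely_metrizable_space
      by blast
    then have "completely_metrizable_space X"
      by (simp add: X_def completely_metrizable_space_prod_topology completely_metrizable_space_discrete_topology)
    moreover have "separable_space X"
    proof -
      obtain D :: "('a \<Rightarrow>\<^sub>L real) set" where D: "countable D" "D \<subseteq> cball 0 1" "dual_ball closure_of D = cball 0 1"
        using second_countable_imp_separable_space[OF dual_ball_metrizable_second_countable(2)[OF d]]
        unfolding separable_space_def topspace_dual_ball by blast
      have "X closure_of (D \<times> UNIV) = topspace X"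
        unfolding X_def closure_of_Times D(3) by (simp add: topspace_dual_ball)
      then show ?thesis
        unfolding separable_space_def using D by (intro exI[of _ "D \<times> UNIV"]) (auto simp: topX)
    qed
    ultimately show "Polish_space X" by (simp add: Polish_space_def)
    show "compactin (pointwise_topology X) (c ` topspace ?E)"
      by (rule image_compactin[OF _ cont]) (use compact_space_enveloping_semigroup compact_space_def in blast)
    show "c ` topspace ?E \<subseteq> Baire_class_1 X"
    proof (rule image_subsetI)
      fix p assume p: "p \<in> topspace ?E"
      have "\<exists>g. (\<forall>m::nat. continuous_map dual_ball euclideanreal (g m)) \<and>
          (\<forall>\<phi>\<in>topspace dual_ball. (\<lambda>m. g m \<phi>) \<longlonglongrightarrow> blinfun_apply (p \<phi>) (d n))" for n
        using no_l1_imp_limit_of_continuous[OF d no p, of "d n"] by (simp add: limit_of_continuous_def)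
      then obtain g where g: "\<And>n m::nat. continuous_map dual_ball euclideanreal (g n m)"
        "\<And>n \<phi>. \<phi> \<in> topspace dual_ball \<Longrightarrow> (\<lambda>m. g n m \<phi>) \<longlonglongrightarrow> blinfun_apply (p \<phi>) (d n)"
        by metis
      have "continuous_map X euclideanreal (\<lambda>(\<phi>, n). g n m \<phi>)" for m
      proof -
        have "openin X {x \<in> topspace X. (\<lambda>(\<phi>, n). g n m \<phi>) x \<in> W}" if "open W" for W
        proof -
          have "openin dual_ball {\<phi> \<in> topspace dual_ball. g n m \<phi> \<in> W}" for n
            by (rule openin_continuous_map_preimage[OF g(1)]) (use that in simp)
          then have "openin X (\<Union>n. {\<phi> \<in> topspace dual_ball. g n m \<phi> \<in> W} \<times> {n})"
            unfolding X_def by (intro openin_Union) (auto simp: openin_prod_Times_iff)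
          moreover have "{x \<in> topspace X. (\<lambda>(\<phi>, n). g n m \<phi>) x \<in> W}
              = (\<Union>n. {\<phi> \<in> topspace dual_ball. g n m \<phi> \<in> W} \<times> {n})"
            by (auto simp: X_def)
          ultimately show ?thesis by simp
        qed
        then show ?thesis by (simp add: continuous_map)
      qed
      moreover have "\<forall>x\<in>topspace X. (\<lambda>m. (\<lambda>(\<phi>, n). g n m \<phi>) x) \<longlonglongrightarrow> c p x"
        using g(2) by (auto simp: topX c_def topspace_dual_ball)
      moreover have "c p \<in> extensional (topspace X)" by (simp add: c_def topX)
      ultimately show "c p \<in> Baire_class_1 X"
        unfolding Baire_class_1_def
        by (intro CollectI conjI exI[of _ "\<lambda>m (\<phi>, n). g n m \<phi>"]) auto
    qed
  qed
qed

section \<open>The compactification of the natural numbers\<close>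

definition nat_cube :: "((nat \<Rightarrow> real) \<Rightarrow> real) topology"
  where "nat_cube = product_topology (\<lambda>_. top_of_set {0..1}) {f. range f \<subseteq> {0..1}}"

definition point_evaluation :: "nat \<Rightarrow> (nat \<Rightarrow> real) \<Rightarrow> real"
  where "point_evaluation n = (\<lambda>f\<in>{f. range f \<subseteq> {0..1}}. f n)"

lemma beta_nat_eq: "beta_nat = subtopology nat_cube (nat_cube closure_of range point_evaluation)"
proof -
  have C: "{f \<in> extensional (topspace (discrete_topology UNIV)).
      continuous_map (discrete_topology UNIV) (top_of_set {0..1}) f} = {f :: nat \<Rightarrow> real. range f \<subseteq> {0..1}}"
    by (auto simp: continuous_map_from_discrete_topology)
  show ?thesis
    unfolding beta_nat_def Cech_Stone_def C Let_def nat_cube_def point_evaluation_def by simp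
qed

lemma topspace_beta_nat: "topspace beta_nat = nat_cube closure_of range point_evaluation"
  unfolding beta_nat_eq by (simp add: inf_absorb2[OF closure_of_subset_topspace])

lemma compact_space_beta_nat: "compact_space beta_nat"
proof -
  have "compact_space nat_cube"
    unfolding nat_cube_def by (simp add: compact_space_product_topology compact_space_subtopology)
  then show ?thesis
    unfolding beta_nat_eq
    by (intro compact_space_subtopology closedin_compact_space closedin_closure_of)
qed

lemma point_evaluation_in_beta_nat: "point_evaluation n \<in> topspace beta_nat"
proof -
  have "range point_evaluation \<subseteq> topspace nat_cube"
    unfolding nat_cube_def point_evaluation_def topspace_product_topology
    by (intro image_subsetI restrict_PiE_iff[THEN iffD2] ballI)
      (simp only: topspace_euclidean_subtopology mem_Collect_eq; blast)
  then show ?thesis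
    unfolding topspace_beta_nat using closure_of_subset by blast
qed

lemma continuous_map_beta_nat_eval:
  assumes "range f \<subseteq> {0..1}"
  shows "continuous_map beta_nat euclideanreal (\<lambda>x. x f)"
proof -
  have "continuous_map nat_cube (top_of_set {0..1}) (\<lambda>x. x f)"
    unfolding nat_cube_def by (rule continuous_map_product_projection) (use assms in simp)
  then show ?thesis
    unfolding beta_nat_eq
    by (intro continuous_map_from_subtopology) (auto dest: continuous_map_into_fulltopology)
qed

text \<open>
  The point evaluations are dense, so a closed condition need only be checked on them.
\<close>

lemma beta_nat_induct:
  assumes x: "x \<in> topspace beta_nat" and "closedin beta_nat {y \<in> topspace beta_nat. P y}"
    and "\<And>n. P (point_evaluation n)"
  shows "P x"
proof -
  have "closedin (subtopology nat_cube (nat_cube closure_of range point_evaluation)) {y \<in> topspace beta_nat. P y}"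
    using assms(2) by (simp only: beta_nat_eq[symmetric])
  then have "closedin nat_cube {y \<in> topspace beta_nat. P y}"
    by (rule closedin_trans_full) simp
  moreover have "range point_evaluation \<subseteq> {y \<in> topspace beta_nat. P y}"
    using assms(3) point_evaluation_in_beta_nat by blast
  ultimately have "nat_cube closure_of range point_evaluation \<subseteq> {y \<in> topspace beta_nat. P y}"
    by (simp only: closure_of_minimal)
  then show ?thesis using x unfolding topspace_beta_nat by blast
qed

section \<open>Spaces with \<open>l\<^sub>1\<close>\<close>

lift_definition l1_unit :: "nat \<Rightarrow> l1" is "\<lambda>n k. if k = n then 1 else 0"
  by (rule summable_finite[of "{n}" for n]) auto

lemma norm_l1_unit: "norm (l1_unit n) = 1"
proof -
  have "(\<lambda>k. \<bar>l1_nth (l1_unit n) k\<bar>) = (\<lambda>k. if k = n then 1 else 0)"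
    by (auto simp: l1_unit.rep_eq)
  then show ?thesis
    using sums_unique[OF sums_single[of n "\<lambda>_. 1 :: real"]] by (simp add: norm_l1_nth)
qed

text \<open>
  On a copy of \<open>l\<^sub>1\<close> every bounded sequence defines a functional by
  summation, and the Hahn-Banach theorem extends it to the whole space.
\<close>

lemma functional_with_prescribed_values:
  fixes J :: "l1 \<Rightarrow> 'a::real_normed_vector"
  assumes J: "linear J" and \<delta>: "0 < \<delta>" "\<And>a. \<delta> * norm a \<le> norm (J a)"
    and g: "range g \<subseteq> {0..1}"
  obtains \<psi> :: "'a::real_normed_vector \<Rightarrow>\<^sub>L real" where "norm \<psi> \<le> 1" "\<And>n. blinfun_apply \<psi> (J (l1_unit n)) = \<delta> * g n"
proof -
  define f where "f a = \<delta> * (\<Sum>n. l1_nth a n * g n)" for a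
  have g01: "0 \<le> g n" "g n \<le> 1" for n using g by (auto simp: image_subset_iff)
  have le: "norm (l1_nth a n * g n) \<le> \<bar>l1_nth a n\<bar>" for a n
    using g01[of n] by (simp add: abs_mult mult_left_le)
  have sums: "summable (\<lambda>n. l1_nth a n * g n)" for a
    by (rule summable_comparison_test'[OF summable_l1_nth[of a]]) (use le in auto)
  have "linear f"
  proof (rule linearI)
    show "f (x + y) = f x + f y" for x y
      unfolding f_def distrib_left[symmetric] suminf_add[OF sums sums]
      by (simp add: plus_l1.rep_eq distrib_right)
    show "f (r *\<^sub>R x) = r *\<^sub>R f x" for r x
      unfolding f_def using suminf_mult[OF sums, of r x]
      by (simp add: scaleR_l1.rep_eq mult.assoc)
  qed
  moreover have "f a \<le> norm (J a)" for a
  proof -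
    have "(\<Sum>n. l1_nth a n * g n) \<le> (\<Sum>n. \<bar>l1_nth a n\<bar>)"
      by (rule suminf_le[OF _ sums summable_l1_nth]) (use le abs_le_D1 in \<open>simp add: abs_le_iff\<close>)
    then have "f a \<le> \<delta> * norm a"
      unfolding f_def norm_l1_nth using \<delta>(1) by (intro mult_left_mono) auto
    then show ?thesis using \<delta>(2) order_trans by blast
  qed
  ultimately obtain \<psi> :: "'a \<Rightarrow>\<^sub>L real" where \<psi>: "norm \<psi> \<le> 1" "\<And>a. blinfun_apply \<psi> (J a) = f a"
    using Hahn_Banach_along_linear[OF J] by metis
  have "f (l1_unit n) = \<delta> * g n" for n
  proof -
    have "(\<lambda>k. l1_nth (l1_unit n) k * g k) = (\<lambda>k. if k = n then g k else 0)"
      by (auto simp: l1_unit.rep_eq)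
    then show ?thesis
      using sums_unique[OF sums_single[of n g]] by (simp add: f_def)
  qed
  then show thesis using that \<psi> by metis
qed

text \<open>
  Let \<open>v n\<close> be the image of the unit vector basis of \<open>l\<^sub>1\<close>. The
  rank-one contractions \<open>x \<mapsto> (\<phi>0 x / M) v n\<close> have adjoints
  \<open>\<psi> \<mapsto> (\<psi> (v n) / M) \<phi>0\<close>. The sequences \<open>\<psi> (v
  n)\<close> include all sequences in a fixed interval, so the closure of these adjoints is that
  of the natural numbers in a full cube of bounded functions, that is, the Cech-Stone
  compactification.
\<close>

lemma l1_imp_beta_nat:
  fixes V :: "'a::banach itself"
  assumes "contains_isomorphic_copy_of_l1 V"
  shows "contains_homeomorphic_copy (enveloping_semigroup V) beta_nat"
proof -
  obtain J :: "l1 \<Rightarrow> 'a" and \<delta> M where J: "linear J" and \<delta>: "0 < \<delta>" "\<And>a. \<delta> * norm a \<le> norm (J a)"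
    and M: "\<And>a. norm (J a) \<le> M * norm a" "0 < M"
    using copy_of_l1E[OF assms] by metis
  define v where "v n = J (l1_unit n)" for n
  have v: "norm (v n) \<le> M" for n using M(1)[of "l1_unit n"] by (simp add: v_def norm_l1_unit)
  have prescribe: "\<exists>\<psi>. norm \<psi> \<le> 1 \<and> (\<forall>n. blinfun_apply \<psi> (v n) = \<delta> * g n)"
    if "range g \<subseteq> {0..1}" for g
    using functional_with_prescribed_values[OF J \<delta> that] unfolding v_def by metis
  obtain \<phi>0 :: "'a \<Rightarrow>\<^sub>L real" where \<phi>0: "norm \<phi>0 \<le> 1" "blinfun_apply \<phi>0 (v 0) = \<delta>"
    using prescribe[of "\<lambda>_. 1"] by auto
  have "\<phi>0 \<noteq> 0" using \<phi>0(2) \<delta>(1) by auto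
  define T where "T n = blinfun_scaleR_left (v n /\<^sub>R M) o\<^sub>L \<phi>0" for n
  have T_apply: "blinfun_apply (T n) x = (blinfun_apply \<phi>0 x / M) *\<^sub>R v n" for n x
    by (simp add: T_def divide_inverse)
  have T: "norm (T n) \<le> 1" for n
  proof (rule norm_blinfun_bound)
    fix x
    have "norm (blinfun_apply (T n) x) = \<bar>blinfun_apply \<phi>0 x\<bar> * (norm (v n) / M)"
      using M(2) by (simp add: T_apply)
    also have "\<dots> \<le> norm x * 1"
      using contraction_apply_le[OF \<phi>0(1), of x] v[of n] M(2) by (intro mult_mono) auto
    finally show "norm (blinfun_apply (T n) x) \<le> 1 * norm x" by simp
  qed simp
  \<comment> \<open>\<open>(T n)\<^sup>* \<psi> = (2 * h \<psi> n - 1) *\<^sub>R \<phi>0\<close>, with \<open>h \<psi>\<close> rescaled to take values in \<open>{0..1}\<close>.\<close>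
  define h where "h \<psi> n = (blinfun_apply \<psi> (v n) / M + 1) / 2" for \<psi> n
  have h: "range (h \<psi>) \<subseteq> {0..1}" if "\<psi> \<in> cball 0 1" for \<psi>
  proof -
    have "\<bar>blinfun_apply \<psi> (v n)\<bar> \<le> M" for n
      using contraction_apply_le[of \<psi> "v n"] that v[of n] by simp
    then have "\<bar>blinfun_apply \<psi> (v n) / M\<bar> \<le> 1" for n using M(2) by simp
    then have q: "- 1 \<le> blinfun_apply \<psi> (v n) / M \<and> blinfun_apply \<psi> (v n) / M \<le> 1" for n
      by (simp only: abs_le_iff minus_le_iff)
    have "0 \<le> h \<psi> n \<and> h \<psi> n \<le> 1" for n using q[of n] by (simp add: h_def)
    then show ?thesis by auto
  qed
  define \<Phi> where "\<Phi> x = (\<lambda>\<psi>\<in>topspace dual_ball. (2 * x (h \<psi>) - 1) *\<^sub>R \<phi>0)"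
    for x :: "(nat \<Rightarrow> real) \<Rightarrow> real"
  have cont: "continuous_map nat_cube dual_ball_self_maps \<Phi>"
    unfolding dual_ball_self_maps_def continuous_map_componentwise
  proof (intro conjI ballI)
    show "\<Phi> ` topspace nat_cube \<subseteq> extensional (topspace dual_ball)" by (auto simp: \<Phi>_def)
    fix \<psi> :: "'a \<Rightarrow>\<^sub>L real" assume \<psi>: "\<psi> \<in> topspace dual_ball"
    have cont_h: "continuous_map nat_cube (top_of_set {0..1}) (\<lambda>x. x (h \<psi>))"
      unfolding nat_cube_def
      by (rule continuous_map_product_projection) (use h \<psi> in \<open>simp add: topspace_dual_ball\<close>)
    have "continuous_map nat_cube dual_ball (\<lambda>x. (2 * x (h \<psi>) - 1) *\<^sub>R \<phi>0)"
    proof (rule continuous_map_into_dual_ball)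
      show "continuous_map nat_cube euclideanreal (\<lambda>x. blinfun_apply ((2 * x (h \<psi>) - 1) *\<^sub>R \<phi>0) w)" for w
        unfolding blinfun.scaleR_left real_scaleR_def
        by (intro continuous_map_real_mult_right continuous_map_diff continuous_map_real_mult_left
            continuous_map_into_fulltopology[OF cont_h] continuous_map_canonical_const)
      have "\<bar>2 * x (h \<psi>) - 1\<bar> * norm \<phi>0 \<le> 1 * 1" if "x \<in> topspace nat_cube" for x
        using continuous_map_image_subset_topspace[OF cont_h] that \<phi>0(1)
        by (intro mult_mono) (auto simp: abs_le_iff)
      then show "(\<lambda>x. (2 * x (h \<psi>) - 1) *\<^sub>R \<phi>0) \<in> topspace nat_cube \<rightarrow> cball 0 1"
        by simp
    qed
    then show "continuous_map nat_cube dual_ball (\<lambda>x. \<Phi> x \<psi>)"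
      using \<psi> by (simp add: \<Phi>_def)
  qed
  have \<Phi>_point: "\<Phi> (point_evaluation n) = restrict (adjoint_op (T n)) (topspace dual_ball)" for n
    unfolding \<Phi>_def
  proof (rule restrict_ext)
    fix \<psi> :: "'a \<Rightarrow>\<^sub>L real" assume \<psi>: "\<psi> \<in> topspace dual_ball"
    then have "point_evaluation n (h \<psi>) = h \<psi> n"
      using h by (simp add: point_evaluation_def topspace_dual_ball)
    then have "2 * point_evaluation n (h \<psi>) - 1 = blinfun_apply \<psi> (v n) / M"
      by (simp add: h_def)
    then show "(2 * point_evaluation n (h \<psi>) - 1) *\<^sub>R \<phi>0 = adjoint_op (T n) \<psi>"
      by (intro blinfun_eqI)
        (simp add: adjoint_op_def h_def T_apply blinfun.scaleR_left blinfun.scaleR_right)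
  qed
  have image: "\<Phi> ` topspace beta_nat \<subseteq> topspace (enveloping_semigroup V)"
  proof -
    have "\<Phi> ` topspace beta_nat \<subseteq> dual_ball_self_maps closure_of (\<Phi> ` range point_evaluation)"
      unfolding topspace_beta_nat by (rule continuous_map_image_closure_subset[OF cont])
    also have "\<dots> \<subseteq> dual_ball_self_maps closure_of adjoint_maps"
      by (rule closure_of_mono) (use \<Phi>_point T in blast)
    finally show ?thesis unfolding topspace_enveloping_semigroup .
  qed
  have inj: "inj_on \<Phi> (topspace beta_nat)"
  proof (rule inj_onI)
    fix x y assume x: "x \<in> topspace beta_nat" and y: "y \<in> topspace beta_nat" and eq: "\<Phi> x = \<Phi> y"
    have "x f = y f" if f: "range f \<subseteq> {0..1}" for f
    proof -
      obtain \<psi> :: "'a \<Rightarrow>\<^sub>L real" where \<psi>: "norm \<psi> \<le> 1" "\<And>n. blinfun_apply \<psi> (v n) = \<delta> * f n"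
        using prescribe[OF f] by blast
      have \<psi>_ball: "\<psi> \<in> cball 0 1" using \<psi>(1) by simp
      \<comment> \<open>\<open>h \<psi>\<close> is an affine function of \<open>f\<close>, hence \<open>\<Phi> z\<close> determines \<open>z f\<close>.\<close>
      have affine: "z (h \<psi>) = (\<delta> * z f / M + 1) / 2" if "z \<in> topspace beta_nat" for z
      proof (rule beta_nat_induct[OF that])
        have "continuous_map beta_nat euclideanreal (\<lambda>z. (\<delta> * z f / M + 1) / 2)"
          using M(2) by (intro continuous_map_real_divide continuous_map_add continuous_map_real_mult_left
              continuous_map_beta_nat_eval[OF f] continuous_map_canonical_const) auto
        then show "closedin beta_nat {z \<in> topspace beta_nat. z (h \<psi>) = (\<delta> * z f / M + 1) / 2}"
          by (intro closedin_continuous_maps_eq[OF _ continuous_map_beta_nat_eval[OF h[OF \<psi>_ball]]]) auto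
        show "point_evaluation n (h \<psi>) = (\<delta> * point_evaluation n f / M + 1) / 2" for n
          using f h[OF \<psi>_ball] by (simp add: point_evaluation_def h_def \<psi>(2))
      qed
      have "(2 * x (h \<psi>) - 1) *\<^sub>R \<phi>0 = (2 * y (h \<psi>) - 1) *\<^sub>R \<phi>0"
        using fun_cong[OF eq, of \<psi>] \<psi>_ball by (simp add: \<Phi>_def topspace_dual_ball)
      then have "x (h \<psi>) = y (h \<psi>)" using \<open>\<phi>0 \<noteq> 0\<close> by simp
      then show ?thesis using affine[OF x] affine[OF y] \<delta>(1) M(2) by simp
    qed
    moreover have "topspace nat_cube \<subseteq> extensional {f. range f \<subseteq> {0..1}}"
      by (auto simp: nat_cube_def PiE_iff)
    then have "topspace beta_nat \<subseteq> extensional {f. range f \<subseteq> {0..1}}"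
      unfolding topspace_beta_nat by (rule order_trans[OF closure_of_subset_topspace])
    then have "x \<in> extensional {f. range f \<subseteq> {0..1}}" "y \<in> extensional {f. range f \<subseteq> {0..1}}"
      using x y by blast+
    ultimately show "x = y" by (metis (no_types, lifting) extensionalityI mem_Collect_eq)
  qed
  have "embedding_map beta_nat (enveloping_semigroup V) \<Phi>"
  proof (rule continuous_imp_embedding_map)
    have "continuous_map beta_nat dual_ball_self_maps \<Phi>"
      unfolding beta_nat_eq by (rule continuous_map_from_subtopology[OF cont])
    then show "continuous_map beta_nat (enveloping_semigroup V) \<Phi>"
      using image unfolding topspace_enveloping_semigroup
      unfolding enveloping_semigroup_def continuous_map_in_subtopology by blast
    show "Hausdorff_space (enveloping_semigroup V)"
      unfolding enveloping_semigroup_def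
      by (rule Hausdorff_space_subtopology[OF Hausdorff_space_dual_ball_self_maps])
  qed (use inj compact_space_beta_nat in auto)
  then have "beta_nat homeomorphic_space subtopology (enveloping_semigroup V) (\<Phi> ` topspace beta_nat)"
    by (rule embedding_map_imp_homeomorphic_space)
  then show ?thesis
    unfolding contains_homeomorphic_copy_def using image homeomorphic_space_sym by blast
qed

section \<open>Cardinalities\<close>

lemma sequences_lepoll_nat_sets: "(UNIV :: (nat \<Rightarrow> real) set) \<lesssim> (UNIV :: nat set set)"
proof -
  obtain h :: "real \<Rightarrow> nat set" where h: "inj h"
    using eqpoll_imp_lepoll[OF eqpoll_sym[OF nat_sets_eqpoll_reals]] unfolding lepoll_def by blast
  define G where "G f = prod_encode ` {(i, j). j \<in> h (f i)}" for f :: "nat \<Rightarrow> real"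
  have "inj G"
  proof (rule injI)
    fix f g assume "G f = G g"
    then have "{(i, j). j \<in> h (f i)} = {(i, j). j \<in> h (g i)}"
      unfolding G_def by (simp add: inj_image_eq_iff inj_prod_encode)
    then have "h (f i) = h (g i)" for i by blast
    then show "f = g" using h by (auto simp: inj_def fun_eq_iff)
  qed
  then show ?thesis unfolding lepoll_def by blast
qed

lemma determined_by_sequence_lepoll:
  fixes c :: "'b \<Rightarrow> nat \<Rightarrow> real"
  assumes "inj_on c A"
  shows "A \<lesssim> (UNIV :: nat set set)"
proof (rule lepoll_trans[OF _ sequences_lepoll_nat_sets])
  show "A \<lesssim> (UNIV :: (nat \<Rightarrow> real) set)" using assms unfolding lepoll_def by blast
qed

lemma Baire_class_1_lepoll:
  assumes "separable_space X"
  shows "Baire_class_1 X \<lesssim> (UNIV :: nat set set)"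
proof -
  obtain C where C: "countable C" "C \<subseteq> topspace X" "X closure_of C = topspace X"
    using assms by (auto simp: separable_space_def)
  define s where "s = from_nat_into (C :: 'a set)"
  have "\<exists>g. (\<forall>n::nat. continuous_map X euclideanreal (g n)) \<and>
        (\<forall>x\<in>topspace X. (\<lambda>n. g n x) \<longlonglongrightarrow> f x)" if "f \<in> Baire_class_1 X" for f
    using that by (simp add: Baire_class_1_def)
  then obtain g where g: "\<And>f n::nat. f \<in> Baire_class_1 X \<Longrightarrow> continuous_map X euclideanreal (g f n)"
    "\<And>f x. f \<in> Baire_class_1 X \<Longrightarrow> x \<in> topspace X \<Longrightarrow> (\<lambda>n. g f n x) \<longlonglongrightarrow> f x"
    by metis
  \<comment> \<open>Code \<open>f\<close> by the values on a dense sequence of continuous functions converging to it.\<close>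
  define c where "c f k = (case prod_decode k of (n, i) \<Rightarrow> g f n (s i))" for f k
  have "inj_on c (Baire_class_1 X)"
  proof (rule inj_onI)
    fix f f' assume f: "f \<in> Baire_class_1 X" and f': "f' \<in> Baire_class_1 X" and eq: "c f = c f'"
    have gs: "g f n (s i) = g f' n (s i)" for n i
      using fun_cong[OF eq, of "prod_encode (n, i)"] by (simp add: c_def)
    have "g f n x = g f' n x" if x: "x \<in> C" for n x
    proof -
      obtain i where "x = s i"
        using from_nat_into_surj[OF C(1) x] unfolding s_def by blast
      then show ?thesis using gs by simp
    qed
    then have eqC: "C \<subseteq> {x \<in> topspace X. g f n x = g f' n x}" for n
      using C(2) by blast
    have "closedin X {x \<in> topspace X. g f n x = g f' n x}" for n
      by (rule closedin_continuous_maps_eq[OF _ g(1)[OF f] g(1)[OF f']]) simp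
    then have "topspace X \<subseteq> {x \<in> topspace X. g f n x = g f' n x}" for n
      using closure_of_minimal[OF eqC] C(3) by metis
    then have "g f n x = g f' n x" if "x \<in> topspace X" for n x using that by blast
    then have "f x = f' x" if "x \<in> topspace X" for x
      using g(2)[OF f that] g(2)[OF f' that] that by (simp add: LIMSEQ_unique)
    moreover have "f \<in> extensional (topspace X)" "f' \<in> extensional (topspace X)"
      using f f' by (auto simp: Baire_class_1_def)
    ultimately show "f = f'" by (metis extensionalityI)
  qed
  then show ?thesis by (rule determined_by_sequence_lepoll)
qed

lemma Rosenthal_compactum_lepoll:
  assumes "Rosenthal_compactum K"
  shows "topspace K \<lesssim> (UNIV :: nat set set)"
proof -
  obtain X :: "real topology" and F where "Polish_space X" and F: "F \<subseteq> Baire_class_1 X"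
    and hom: "K homeomorphic_space subtopology (pointwise_topology X) F"
    using assms unfolding Rosenthal_compactum_def by blast
  then have "Baire_class_1 X \<lesssim> (UNIV :: nat set set)"
    by (intro Baire_class_1_lepoll) (simp add: Polish_space_def)
  moreover obtain h where "homeomorphic_map K (subtopology (pointwise_topology X) F) h"
    using hom homeomorphic_space by blast
  then have "inj_on h (topspace K)" "h ` topspace K \<subseteq> Baire_class_1 X"
    using F by (auto simp: homeomorphic_eq_everything_map)
  then have "topspace K \<lesssim> Baire_class_1 X" unfolding lepoll_def by blast
  ultimately show ?thesis by (rule lepoll_trans[rotated])
qed

lemma self_maps_lepoll:
  assumes "A \<lesssim> (UNIV :: nat set set)"
  shows "(A \<rightarrow>\<^sub>E A) \<lesssim> (UNIV :: nat set set set)"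
proof -
  obtain h :: "_ \<Rightarrow> nat set" where h: "inj_on h A" using assms unfolding lepoll_def by blast
  define code :: "nat set \<Rightarrow> nat set \<Rightarrow> nat set" where "code S T = (\<lambda>n. 2 * n) ` S \<union> (\<lambda>n. Suc (2 * n)) ` T" for S T
  have code: "S = S' \<and> T = T'" if "code S T = code S' T'" for S T S' T'
  proof -
    have "S = {n. 2 * n \<in> code S T}" "T = {n. Suc (2 * n) \<in> code S T}" for S T
      by (auto simp: code_def) presburger+
    then show ?thesis using that by metis
  qed
  \<comment> \<open>The graph of \<open>p\<close>, as a set of codes of pairs.\<close>
  define G where "G p = (\<lambda>a. code (h a) (h (p a))) ` A" for p
  have "inj_on G (A \<rightarrow>\<^sub>E A)"
  proof (rule inj_onI)
    fix p q assume p: "p \<in> A \<rightarrow>\<^sub>E A" and q: "q \<in> A \<rightarrow>\<^sub>E A" and "G p = G q"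
    have "p a = q a" if a: "a \<in> A" for a
    proof -
      have "code (h a) (h (p a)) \<in> G q" using \<open>G p = G q\<close> a by (auto simp: G_def)
      then obtain b where b: "b \<in> A" "code (h a) (h (p a)) = code (h b) (h (q b))"
        by (auto simp: G_def)
      then have "h a = h b" "h (p a) = h (q b)" using code by blast+
      then show ?thesis using h a b(1) p q by (metis PiE_mem inj_onD)
    qed
    then show "p = q" using p q by (metis PiE_ext)
  qed
  then show ?thesis unfolding lepoll_def by blast
qed

lemma enveloping_semigroup_lepoll:
  fixes V :: "'a::banach itself"
  assumes d: "dense_sequence (d :: nat \<Rightarrow> 'a)"
  shows "topspace (enveloping_semigroup V) \<lesssim> (UNIV :: nat set set set)"
proof -
  have "inj_on (\<lambda>\<phi> n. blinfun_apply \<phi> (d n)) (cball (0 :: 'a \<Rightarrow>\<^sub>L real) 1)"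
    by (rule inj_onI) (metis dense_sequence_blinfun_eq[OF d])
  then have "cball (0 :: 'a \<Rightarrow>\<^sub>L real) 1 \<lesssim> (UNIV :: nat set set)"
    by (rule determined_by_sequence_lepoll)
  then have "(cball (0 :: 'a \<Rightarrow>\<^sub>L real) 1 \<rightarrow>\<^sub>E cball (0 :: 'a \<Rightarrow>\<^sub>L real) 1) \<lesssim> (UNIV :: nat set set set)"
    by (rule self_maps_lepoll)
  moreover have "topspace (enveloping_semigroup V) \<subseteq> cball 0 1 \<rightarrow>\<^sub>E cball 0 1"
    unfolding topspace_enveloping_semigroup topspace_dual_ball_self_maps[symmetric]
    by (rule closure_of_subset_topspace)
  ultimately show ?thesis by (meson lepoll_trans subset_imp_lepoll)
qed

text \<open>
  Hausdorff's independent family: a set is recorded by its traces on initial segments, and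
  finitely many sets are told apart by their traces on a sufficiently long one.
\<close>

lemma independent_family:
  "\<exists>X :: nat set \<Rightarrow> nat set. \<forall>\<A> \<B>. finite \<A> \<longrightarrow> finite \<B> \<longrightarrow> \<A> \<inter> \<B> = {} \<longrightarrow>
      (\<exists>n. (\<forall>A\<in>\<A>. n \<in> X A) \<and> (\<forall>B\<in>\<B>. n \<notin> X B))"
proof -
  define idx :: "nat \<Rightarrow> nat \<times> nat list list" where "idx = from_nat"
  \<comment> \<open>The natural numbers are used as codes of pairs \<open>(k, L)\<close>, where \<open>L\<close> lists subsets of
    \<open>{..<k}\<close>; \<open>X A\<close> consists of the pairs for which \<open>L\<close> contains the trace of \<open>A\<close>.\<close>
  define enc :: "nat set \<Rightarrow> nat \<Rightarrow> nat list" where "enc A k = sorted_list_of_set (A \<inter> {..<k})" for A k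
  have enc: "set (enc A k) = A \<inter> {..<k}" for A k by (simp add: enc_def)
  define X where "X A = {n. case idx n of (k, L) \<Rightarrow> enc A k \<in> set L}" for A
  show ?thesis
  proof (intro exI[of _ X] allI impI)
    fix \<A> \<B> :: "nat set set"
    assume fin: "finite \<A>" "finite \<B>" and disj: "\<A> \<inter> \<B> = {}"
    define w where "w p = (LEAST i. (i \<in> fst p) \<noteq> (i \<in> snd p))" for p :: "nat set \<times> nat set"
    have w: "(w (A, B) \<in> A) \<noteq> (w (A, B) \<in> B)" if "A \<noteq> B" for A B
    proof -
      have "\<exists>i. (i \<in> A) \<noteq> (i \<in> B)" using that by blast
      then show ?thesis
        unfolding w_def fst_conv snd_conv by (rule LeastI_ex[of "\<lambda>i. (i \<in> A) \<noteq> (i \<in> B)"])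
    qed
    \<comment> \<open>Below \<open>k\<close> every set of \<open>\<A>\<close> already differs from every set of \<open>\<B>\<close>.\<close>
    define k where "k = Suc (Max (insert 0 (w ` (\<A> \<times> \<B>))))"
    have k: "w (A, B) < k" if "A \<in> \<A>" "B \<in> \<B>" for A B
      unfolding k_def less_Suc_eq_le by (rule Max_ge) (use fin that in auto)
    obtain L where L: "set L = (\<lambda>A. enc A k) ` \<A>"
      using finite_list[of "(\<lambda>A. enc A k) ` \<A>"] fin by auto
    have idx: "idx (to_nat (k, L)) = (k, L)" by (simp add: idx_def)
    have "to_nat (k, L) \<in> X A" if "A \<in> \<A>" for A
      using that L idx by (simp add: X_def)
    moreover have "to_nat (k, L) \<notin> X B" if B: "B \<in> \<B>" for B
    proof
      assume "to_nat (k, L) \<in> X B"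
      then obtain A where A: "A \<in> \<A>" "enc B k = enc A k"
        using L idx by (auto simp: X_def)
      then have "B \<inter> {..<k} = A \<inter> {..<k}" using enc by metis
      moreover have "A \<noteq> B" using A(1) B disj by blast
      ultimately show False using w[OF \<open>A \<noteq> B\<close>] k[OF A(1) B] by blast
    qed
    ultimately show "\<exists>n. (\<forall>A\<in>\<A>. n \<in> X A) \<and> (\<forall>B\<in>\<B>. n \<notin> X B)" by blast
  qed
qed

text \<open>
  Let \<open>X A\<close> be an independent family. By compactness every set \<open>\<A>\<close>
  of indices is realized by a point whose value at the indicator function of \<open>X A\<close>
  is 1 for \<open>A\<close> in \<open>\<A>\<close> and 0 otherwise; different
  \<open>\<A>\<close> give different points.
\<close>

lemma nat_sets_sets_lepoll_beta_nat: "(UNIV :: nat set set set) \<lesssim> topspace beta_nat"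
proof -
  obtain X :: "nat set \<Rightarrow> nat set" where X: "\<And>\<A> \<B>. finite \<A> \<Longrightarrow> finite \<B> \<Longrightarrow> \<A> \<inter> \<B> = {} \<Longrightarrow>
      \<exists>n. (\<forall>A\<in>\<A>. n \<in> X A) \<and> (\<forall>B\<in>\<B>. n \<notin> X B)"
    using independent_family by metis
  define i :: "nat set \<Rightarrow> nat \<Rightarrow> real" where "i A = indicator (X A)" for A
  have i: "range (i A) \<subseteq> {0..1}" for A by (auto simp: i_def indicator_def)
  have "\<exists>x\<in>topspace beta_nat. \<forall>A. x (i A) = (if A \<in> \<A> then 1 else 0)" for \<A>
  proof -
    \<comment> \<open>Independence of the sets \<open>X A\<close> is the finite intersection property of these conditions.\<close>
    define C where "C A = {x \<in> topspace beta_nat. x (i A) \<in> {if A \<in> \<A> then 1 else 0}}" for A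
    have "\<Inter>(range C) \<noteq> {}"
    proof (rule compact_space_fip[THEN iffD1, OF compact_space_beta_nat, rule_format])
      have "closedin beta_nat (C A)" for A
        unfolding C_def
        by (rule closedin_continuous_map_preimage[OF continuous_map_beta_nat_eval[OF i]]) simp
      then show "(\<forall>D\<in>range C. closedin beta_nat D) \<and> (\<forall>\<F>. finite \<F> \<and> \<F> \<subseteq> range C \<longrightarrow> \<Inter>\<F> \<noteq> {})"
      proof (intro conjI allI impI)
        fix \<F> assume "finite \<F> \<and> \<F> \<subseteq> range C"
        then obtain \<G> where \<G>: "finite \<G>" "\<F> = C ` \<G>" by (meson finite_subset_image)
        obtain n where n: "\<forall>A\<in>\<G> \<inter> \<A>. n \<in> X A" "\<forall>B\<in>\<G> - \<A>. n \<notin> X B"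
          using X[of "\<G> \<inter> \<A>" "\<G> - \<A>"] \<G>(1) by auto
        have "point_evaluation n \<in> C A" if "A \<in> \<G>" for A
          using n that point_evaluation_in_beta_nat i[of A]
          by (auto simp: C_def point_evaluation_def i_def indicator_def)
        then show "\<Inter>\<F> \<noteq> {}" unfolding \<G>(2) by blast
      qed auto
    qed
    then obtain x where "\<And>A. x \<in> C A" by blast
    then show ?thesis by (intro bexI[of _ x]) (auto simp: C_def)
  qed
  then obtain u where u: "\<And>\<A>. u \<A> \<in> topspace beta_nat" "\<And>\<A> A. u \<A> (i A) = (if A \<in> \<A> then 1 else 0)"
    by metis
  have "inj u"
  proof (rule injI)
    fix \<A> \<B> assume "u \<A> = u \<B>"
    then have "A \<in> \<A> \<longleftrightarrow> A \<in> \<B>" for A using u(2)[of \<A> A] u(2)[of \<B> A] by (auto split: if_splits)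
    then show "\<A> = \<B>" by blast
  qed
  then show ?thesis using u(1) unfolding lepoll_def by blast
qed

lemma not_nat_sets_sets_lepoll_nat_sets: "\<not> (UNIV :: nat set set set) \<lesssim> (UNIV :: nat set set)"
proof
  assume "(UNIV :: nat set set set) \<lesssim> (UNIV :: nat set set)"
  then obtain f :: "nat set \<Rightarrow> nat set set" where "UNIV \<subseteq> range f" unfolding lepoll_iff by blast
  then show False using Cantors_theorem[of "UNIV :: nat set set"] by auto
qed

lemma homeomorphic_copy_lepoll:
  assumes "contains_homeomorphic_copy K L"
  shows "topspace L \<lesssim> topspace K"
proof -
  obtain S where S: "S \<subseteq> topspace K" "subtopology K S homeomorphic_space L"
    using assms unfolding contains_homeomorphic_copy_def by blast
  then obtain f where "homeomorphic_map L (subtopology K S) f"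
    using homeomorphic_space homeomorphic_space_sym by blast
  then have "inj_on f (topspace L)" "f ` topspace L = S"
    using S(1) by (auto simp: homeomorphic_eq_everything_map)
  then show ?thesis unfolding lepoll_def using S(1) by blast
qed

section \<open>The dichotomy\<close>

theorem theorem6p22:
  fixes V :: "'a::banach itself"
  assumes "separable_space (euclidean :: 'a topology)"
  defines "E \<equiv> enveloping_semigroup V"
  shows "compact_space E \<and> separable_space E \<and>
    (Rosenthal_compactum E \<and> topspace E \<lesssim> (UNIV :: nat set set) \<or>
     contains_homeomorphic_copy E beta_nat \<and> topspace E \<approx> (UNIV :: nat set set set)) \<and>
    \<not> (Rosenthal_compactum E \<and> contains_homeomorphic_copy E beta_nat) \<and>
    (Rosenthal_compactum E \<longleftrightarrow> Rosenthal_Banach_space V)"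
proof -
  obtain d :: "nat \<Rightarrow> 'a" where d: "dense_sequence d"
    using separable_imp_dense_sequence[OF assms(1)] by blast
  have large: "(UNIV :: nat set set set) \<lesssim> topspace E" if "contains_homeomorphic_copy E beta_nat"
    using nat_sets_sets_lepoll_beta_nat homeomorphic_copy_lepoll[OF that] by (rule lepoll_trans)
  have exclusive: "\<not> (Rosenthal_compactum E \<and> contains_homeomorphic_copy E beta_nat)"
    using large Rosenthal_compactum_lepoll[of E] not_nat_sets_sets_lepoll_nat_sets lepoll_trans by blast
  have l1: "contains_homeomorphic_copy E beta_nat" if "contains_isomorphic_copy_of_l1 V"
    using l1_imp_beta_nat[OF that] by (simp add: E_def)
  have no_l1: "Rosenthal_compactum E" if "\<not> contains_isomorphic_copy_of_l1 V"
    using no_l1_imp_Rosenthal_compactum[OF d that] by (simp add: E_def)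
  have "topspace E \<approx> (UNIV :: nat set set set)" if "contains_homeomorphic_copy E beta_nat"
    using enveloping_semigroup_lepoll[OF d, of V] large[OF that] by (simp add: E_def lepoll_antisym)
  moreover have "compact_space E" "separable_space E"
    unfolding E_def by (rule compact_space_enveloping_semigroup separable_space_enveloping_semigroup[OF d])+
  ultimately show ?thesis
    using exclusive l1 no_l1 Rosenthal_compactum_lepoll[of E]
    unfolding Rosenthal_Banach_space_def by blast
qed

end
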